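(* Let $\{s_n\}$ be an infinite sequence of pairwise distinct nonzero real numbers with $s_n\to0$, and assume that $\{t_n\}$, where $t_n=s_n^{-1}$, is a removable spectrum. Let $$A(z)=\lim_{R\to\infty}\prod_{|t_n|\le R}\Big(1-\frac{z}{t_n}\Big)$$ be the corresponding function in the Krein class $\mathcal{K}_1$. Assume that for some $\gamma\in(0,2)$ we have $$\sum_n\frac{1}{|t_n|^{\gamma}|A'(t_n)|}<\infty.$$ Let $\mathcal{A}_0$ be a selfadjoint operator with the (simple) point spectrum $\{s_n\}$ and trivial kernel, i.e., $\mathcal{A}_0$ is the operator of multiplication by $x$ in $L^2(\nu)$, where $\nu=\sum_n\nu_n\delta_{s_n}$ with $\nu_n>0$. Then for any $\alpha_1,\alpha_2\in[0,1)$ with $\alpha_1+\alpha_2\le 2-\gamma$ there exist $a\in|x|^{\alpha_1}L^2(\nu)$ and $b\in|x|^{\alpha_2}L^2(\nu)$ such that $a,b\notin xL^2(\nu)$ and the spectrum of the perturbed operator $\mathcal{L}_0=\mathcal{A}_0+ab^*$ equals $\{0\}$.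
   Context: Here $|x|^{\alpha}L^2(\nu)=\{|x|^{\alpha}f: f\in L^2(\nu)\}$ and $xL^2(\nu)=\{xf: f\in L^2(\nu)\}$ is the range of $\mathcal{A}_0$; $ab^*$ denotes the operator $f\mapsto (f,b)\,a$ on $L^2(\nu)$. Removable spectra. Let $\{t_n\}$ be an infinite sequence of pairwise distinct nonzero real numbers with $|t_n|\to\infty$, let $\mu=\sum_n\mu_n\delta_{t_n}$ with masses $\mu_n>0$, and let $\mathcal{A}$ be the selfadjoint operator of multiplication by the independent variable $x$ in $L^2(\mu)$ with its natural domain $\mathcal{D}(\mathcal{A})=\{f\in L^2(\mu): xf\in L^2(\mu)\}$; $\mathcal{A}^{-1}$ is bounded. Let $a,b$ be functions with $a/x,\ b/x\in L^2(\mu)$ (possibly $a,b\notin L^2(\mu)$) and let $\varkappa\in\mathbb{C}$ be such that $\varkappa\neq\int_{\mathbb{R}}x^{-1}a(x)\overline{b(x)}\,d\mu(x)$ in the case when $a\in L^2(\mu)$ (no condition on $\varkappa$ if $a\notin L^2(\mu)$). The singular rank one perturbation $\mathcal{L}=\mathcal{L}(\mathcal{A},a,b,\varkappa)$ of $\mathcal{A}$ is the operator in $L^2(\mu)$ defined by $$\mathcal{D}(\mathcal{L})=\{y=y_0+c\cdot\mathcal{A}^{-1}a:\ c\in\mathbb{C},\ y_0\in\mathcal{D}(\mathcal{A}),\ \varkappa c+\langle y_0,b\rangle=0\},\qquad \mathcal{L}y=\mathcal{A}y_0,$$ where $\mathcal{A}^{-1}a$ denotes the function $a/x$ and $\langle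 y_0,b\rangle=\int y_0\overline{b}\,d\mu$. The spectrum $\{t_n\}$ is called removable if there exists a singular rank one perturbation $\mathcal{L}(\mathcal{A},a,b,\varkappa)$ of $\mathcal{A}$ whose spectrum is empty. This property does not depend on the choice of the masses $\mu_n>0$. For a removable spectrum the limit defining $A$ exists and $A$ belongs to $\mathcal{K}_1$. Krein class. An entire function $F$ with $F(0)\neq0$ belongs to the Krein class $\mathcal{K}_1$ if it is real on $\mathbb{R}$, has only real simple zeros $t_n$, and may be represented as $$\frac{1}{F(z)}=q+\sum_n c_n\Big(\frac{1}{t_n-z}-\frac{1}{t_n}\Big),\qquad \sum_n t_n^{-2}|c_n|<\infty,$$ where $c_n=-1/F'(t_n)$ and $q=1/F(0)$. *)

theory Defs
  imports "HOL-Complex_Analysis.Complex_Analysis"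
begin

text \<open>
  The space \<open>L\<^sup>2(M)\<close> of a measure \<open>M\<close> on the real line is handled through representatives:
  its elements are square integrable functions, and two of them are identified when they agree
  almost everywhere.  All notions below (spectrum, membership in \<open>w L\<^sup>2(M)\<close>) are invariant under
  this identification.
\<close>

definition atomic_measure :: "(nat \<Rightarrow> real) \<Rightarrow> (nat \<Rightarrow> real) \<Rightarrow> real measure" where
  \<comment> \<open>the measure \<open>\<Sum>\<^sub>n w\<^sub>n \<delta>\<^bsub>p\<^sub>n\<^esub>\<close>, as the image under \<open>p\<close> of the measure on \<open>\<nat>\<close> with weights \<open>w\<close>\<close>
  "atomic_measure w p = distr (point_measure UNIV (\<lambda>n. ennreal (w n))) borel p"

definition L2 :: "real measure \<Rightarrow> (real \<Rightarrow> complex) set" where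
  "L2 M = {f \<in> borel_measurable M. integrable M (\<lambda>x. (cmod (f x))\<^sup>2)}"

definition L2_norm :: "real measure \<Rightarrow> (real \<Rightarrow> complex) \<Rightarrow> real" where
  "L2_norm M f = sqrt (\<integral>x. (cmod (f x))\<^sup>2 \<partial>M)"

definition L2_inner :: "real measure \<Rightarrow> (real \<Rightarrow> complex) \<Rightarrow> (real \<Rightarrow> complex) \<Rightarrow> complex" where
  \<comment> \<open>also used for the extended pairing of \<open>f\<close>, \<open>g\<close> that need not lie in \<open>L\<^sup>2\<close> but have
     integrable product\<close>
  "L2_inner M f g = (\<integral>x. f x * cnj (g x) \<partial>M)"

definition weighted_L2 :: "(real \<Rightarrow> real) \<Rightarrow> real measure \<Rightarrow> (real \<Rightarrow> complex) set" where
  "weighted_L2 w M =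
     {f \<in> borel_measurable M. \<exists>g \<in> L2 M. AE x in M. f x = of_real (w x) * g x}"

text \<open>
  A (possibly unbounded) linear operator \<open>T\<close> in \<open>L\<^sup>2(M)\<close> is represented by its graph, the set of
  pairs \<open>(f, T f)\<close> with \<open>f\<close> in the domain.  A number \<open>\<zeta>\<close> belongs to the resolvent set when
  \<open>T - \<zeta>\<close> is a bijection of the domain onto \<open>L\<^sup>2(M)\<close> with bounded inverse.
\<close>

type_synonym L2_operator = "((real \<Rightarrow> complex) \<times> (real \<Rightarrow> complex)) set"

definition resolvent_set :: "real measure \<Rightarrow> L2_operator \<Rightarrow> complex set" where
  "resolvent_set M T = {\<zeta>.
     (\<forall>(f, g) \<in> T. \<forall>(f', g') \<in> T.
        (AE x in M. g x - \<zeta> * f x = g' x - \<zeta> * f' x) \<longrightarrow> (AE x in M. f x = f' x)) \<and>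
     (\<forall>h \<in> L2 M. \<exists>(f, g) \<in> T. AE x in M. g x - \<zeta> * f x = h x) \<and>
     (\<exists>C. \<forall>(f, g) \<in> T. L2_norm M f \<le> C * L2_norm M (\<lambda>x. g x - \<zeta> * f x))}"

definition spectrum :: "real measure \<Rightarrow> L2_operator \<Rightarrow> complex set" where
  "spectrum M T = - resolvent_set M T"

definition mult_domain :: "real measure \<Rightarrow> (real \<Rightarrow> complex) set" where
  \<comment> \<open>natural domain of multiplication by the independent variable\<close>
  "mult_domain M = {f \<in> L2 M. (\<lambda>x. of_real x * f x) \<in> L2 M}"

definition rank_one_perturbation ::
  "real measure \<Rightarrow> (real \<Rightarrow> complex) \<Rightarrow> (real \<Rightarrow> complex) \<Rightarrow> L2_operator" where
  \<comment> \<open>\<open>\<A>\<^sub>0 + a b\<^sup>*\<close>, with \<open>\<A>\<^sub>0\<close> the multiplication by \<open>x\<close> and \<open>a, b \<in> L\<^sup>2(M)\<close>\<close>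
  "rank_one_perturbation M a b =
     {(f, \<lambda>x. of_real x * f x + L2_inner M f b * a x) | f. f \<in> mult_domain M}"

definition singular_data ::
  "real measure \<Rightarrow> (real \<Rightarrow> complex) \<Rightarrow> (real \<Rightarrow> complex) \<Rightarrow> complex \<Rightarrow> bool" where
  \<comment> \<open>the condition on \<open>\<kappa>\<close> makes the perturbed operator below single-valued when \<open>a \<in> L\<^sup>2(M)\<close>\<close>
  "singular_data M a b \<kappa> \<longleftrightarrow>
     (\<lambda>x. a x / of_real x) \<in> L2 M \<and> (\<lambda>x. b x / of_real x) \<in> L2 M \<and>
     (a \<in> L2 M \<longrightarrow> \<kappa> \<noteq> (\<integral>x. a x * cnj (b x) / of_real x \<partial>M))"

definition singular_perturbation ::
  "real measure \<Rightarrow> (real \<Rightarrow> complex) \<Rightarrow> (real \<Rightarrow> complex) \<Rightarrow> complex \<Rightarrow> L2_operator" where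
  "singular_perturbation M a b \<kappa> =
     {(\<lambda>x. y0 x + c * (a x / of_real x), \<lambda>x. of_real x * y0 x) | y0 c.
        y0 \<in> mult_domain M \<and> \<kappa> * c + L2_inner M y0 b = 0}"

definition removable_spectrum :: "(nat \<Rightarrow> real) \<Rightarrow> bool" where
  \<comment> \<open>the choice of the masses \<open>\<mu>\<close> is immaterial: different choices give unitarily equivalent
     multiplication operators\<close>
  "removable_spectrum t \<longleftrightarrow>
     (\<exists>\<mu> a b \<kappa>. (\<forall>n. 0 < \<mu> n) \<and> singular_data (atomic_measure \<mu> t) a b \<kappa> \<and>
        spectrum (atomic_measure \<mu> t) (singular_perturbation (atomic_measure \<mu> t) a b \<kappa>) = {})"

definition Krein_class :: "(complex \<Rightarrow> complex) set" where
  \<comment> \<open>here \<open>c\<^sub>t = - 1 / F'(t)\<close> for a zero \<open>t\<close>; the series is indexed by the set of zeros, which is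
     legitimate since it converges absolutely\<close>
  "Krein_class = {F. F holomorphic_on UNIV \<and> F 0 \<noteq> 0 \<and> (\<forall>x \<in> \<real>. F x \<in> \<real>) \<and>
     (\<forall>t. F t = 0 \<longrightarrow> t \<in> \<real> \<and> deriv F t \<noteq> 0) \<and>
     (\<lambda>t. cmod (- 1 / deriv F t) / (cmod t)\<^sup>2) summable_on {t. F t = 0} \<and>
     (\<forall>z. F z \<noteq> 0 \<longrightarrow>
        ((\<lambda>t. (- 1 / deriv F t) * (1 / (t - z) - 1 / t)) has_sum (1 / F z - 1 / F 0))
          {t. F t = 0})}"

end

theory Submission
  imports Defs
begin

text \<open>
  Put \<open>\<phi> \<zeta> = 1 + \<Sum> \<nu> n * a (s n) * cnj (b (s n)) / (s n - \<zeta>)\<close>.  For \<open>\<zeta> \<noteq> 0\<close> outside the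
  sequence \<open>s\<close>, the equation \<open>(x - \<zeta>) f + (f, b) a = h\<close> reduces to a scalar equation for \<open>(f, b)\<close>
  with coefficient \<open>\<phi> \<zeta>\<close>, so that \<open>\<zeta>\<close> is in the resolvent set if \<open>\<phi> \<zeta> \<noteq> 0\<close>
  (\<open>rank_one_resolvent_off_atoms\<close>).  The points \<open>s m\<close> are in the resolvent set as soon as \<open>a\<close> and \<open>b\<close>
  do not vanish there (\<open>rank_one_resolvent_at_atom\<close>), and \<open>0\<close> is always in the spectrum when
  \<open>b\<close> vanishes at no \<open>s n\<close>, because the perturbation does nothing on the orthogonal complement
  of \<open>b\<close> (\<open>zero_in_spectrum\<close>).

  The expansion of \<open>1 / A\<close> provided by the Krein class, written in the variable \<open>z = 1 / \<zeta>\<close>, says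
  precisely that \<open>\<phi> \<zeta> = 1 / A (1 / \<zeta>)\<close> if \<open>\<nu> n * a (s n) * cnj (b (s n)) = 1 / ((t n)\<^sup>2 * A' (t n))\<close>,
  and then \<open>\<phi>\<close> has no zeros.  This uses that the zeros of \<open>A\<close> are exactly the points \<open>t n\<close>, which
  has to be extracted from the conditionally convergent product
  (\<open>principal_value_product_real_zeros\<close>).

  Only the product of \<open>a\<close> and \<open>cnj b\<close> is prescribed, so the moduli may still be distributed between
  them.  The assumption on \<open>\<gamma>\<close> implies that the square roots of the products of the terms of the two
  weighted norms are summable, hence an even distribution satisfies both integrability conditions.
  The conditions \<open>a, b \<notin> x L\<^sup>2\<close> involve strictly stronger weights, as \<open>\<alpha>1, \<alpha>2 < 1\<close>, and are forced
  by making \<open>a\<close>, respectively \<open>b\<close>, larger on two disjoint sparse sets of indices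
  (\<open>factorization_with_divergent_moments\<close>).
\<close>

section \<open>Square integrable functions\<close>

lemma L2_measurable [measurable_dest]: "f \<in> L2 M \<Longrightarrow> f \<in> borel_measurable M"
  by (simp add: L2_def)

lemma L2_integrable: "f \<in> L2 M \<Longrightarrow> integrable M (\<lambda>x. (cmod (f x))\<^sup>2)"
  by (simp add: L2_def)

lemma L2_norm_nonneg [simp]: "0 \<le> L2_norm M f"
  by (simp add: L2_norm_def)

lemma L2_norm_power2: "(L2_norm M f)\<^sup>2 = (\<integral>x. (cmod (f x))\<^sup>2 \<partial>M)"
  by (simp add: L2_norm_def)

text \<open>
  Membership and norm bounds for scalar multiples, products with bounded functions and quotients by
  \<open>x - \<zeta>\<close> are all instances of this comparison of moduli.
\<close>

lemma
  assumes f: "f \<in> L2 M" and g: "g \<in> borel_measurable M"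
    and B: "AE x in M. cmod (g x) \<le> B * cmod (f x)" and "0 \<le> B"
  shows L2_dominated: "g \<in> L2 M"
    and L2_norm_dominated: "L2_norm M g \<le> B * L2_norm M f"
proof -
  note [measurable] = f g
  have ae: "AE x in M. (cmod (g x))\<^sup>2 \<le> B\<^sup>2 * (cmod (f x))\<^sup>2"
    using B
  proof eventually_elim
    case (elim x)
    then show ?case using power_mono[OF elim norm_ge_zero, of 2] by (simp add: power_mult_distrib)
  qed
  have int: "integrable M (\<lambda>x. B\<^sup>2 * (cmod (f x))\<^sup>2)"
    using L2_integrable[OF f] by simp
  have int_g: "integrable M (\<lambda>x. (cmod (g x))\<^sup>2)"
  proof (rule Bochner_Integration.integrable_bound[OF int])
    show "AE x in M. norm ((cmod (g x))\<^sup>2) \<le> norm (B\<^sup>2 * (cmod (f x))\<^sup>2)"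
      using ae by simp
  qed measurable
  then show "g \<in> L2 M" using g by (simp add: L2_def)
  have "(L2_norm M g)\<^sup>2 \<le> (\<integral>x. B\<^sup>2 * (cmod (f x))\<^sup>2 \<partial>M)"
    unfolding L2_norm_power2 by (rule integral_mono_AE[OF int_g int ae])
  also have "\<dots> = (B * L2_norm M f)\<^sup>2"
    by (simp add: power_mult_distrib L2_norm_power2)
  finally show "L2_norm M g \<le> B * L2_norm M f"
    by (rule power2_le_imp_le) (simp add: \<open>0 \<le> B\<close>)
qed

lemma
  assumes f: "f \<in> L2 M" and g: "g \<in> L2 M"
  shows integrable_norm_mult_L2: "integrable M (\<lambda>x. cmod (f x) * cmod (g x))"
    and Cauchy_Schwarz_L2: "(\<integral>x. cmod (f x) * cmod (g x) \<partial>M) \<le> L2_norm M f * L2_norm M g"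
proof -
  note [measurable] = f g
  show int: "integrable M (\<lambda>x. cmod (f x) * cmod (g x))"
  proof (rule Bochner_Integration.integrable_bound)
    show "integrable M (\<lambda>x. (cmod (f x))\<^sup>2 + (cmod (g x))\<^sup>2)"
      using L2_integrable[OF f] L2_integrable[OF g] by simp
    have "x * y \<le> x\<^sup>2 + y\<^sup>2" if "0 \<le> x" "0 \<le> y" for x y :: real
      using sum_squares_bound[of x y] mult_nonneg_nonneg[OF that] by linarith
    then show "AE x in M. norm (cmod (f x) * cmod (g x)) \<le> norm ((cmod (f x))\<^sup>2 + (cmod (g x))\<^sup>2)"
      by auto
  qed measurable
  have nn: "(\<integral>\<^sup>+x. ennreal (h x) \<partial>M) = ennreal (\<integral>x. h x \<partial>M)"
    if "integrable M h" "\<And>x. 0 \<le> h x" for h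
    using that by (intro nn_integral_eq_integral) auto
  have "(\<integral>\<^sup>+x. ennreal (cmod (f x)) * ennreal (cmod (g x)) \<partial>M)\<^sup>2 \<le>
    (\<integral>\<^sup>+x. (ennreal (cmod (f x)))\<^sup>2 \<partial>M) * (\<integral>\<^sup>+x. (ennreal (cmod (g x)))\<^sup>2 \<partial>M)"
    by (rule Cauchy_Schwarz_nn_integral) measurable
  also have "(\<integral>\<^sup>+x. ennreal (cmod (f x)) * ennreal (cmod (g x)) \<partial>M) =
      ennreal (\<integral>x. cmod (f x) * cmod (g x) \<partial>M)"
    using nn[OF int] by (simp add: ennreal_mult'')
  also have "(\<integral>\<^sup>+x. (ennreal (cmod (f x)))\<^sup>2 \<partial>M) = ennreal ((L2_norm M f)\<^sup>2)"
    using nn[OF L2_integrable[OF f]] by (simp add: ennreal_power L2_norm_power2)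
  also have "(\<integral>\<^sup>+x. (ennreal (cmod (g x)))\<^sup>2 \<partial>M) = ennreal ((L2_norm M g)\<^sup>2)"
    using nn[OF L2_integrable[OF g]] by (simp add: ennreal_power L2_norm_power2)
  also have "ennreal ((L2_norm M f)\<^sup>2) * ennreal ((L2_norm M g)\<^sup>2) =
      ennreal ((L2_norm M f * L2_norm M g)\<^sup>2)"
    by (simp only: power_mult_distrib ennreal_mult'' zero_le_power2)
  finally have "(\<integral>x. cmod (f x) * cmod (g x) \<partial>M)\<^sup>2 \<le> (L2_norm M f * L2_norm M g)\<^sup>2"
    by (simp add: ennreal_power ennreal_le_iff)
  then show "(\<integral>x. cmod (f x) * cmod (g x) \<partial>M) \<le> L2_norm M f * L2_norm M g"
    by (rule power2_le_imp_le) simp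
qed

lemma borel_measurable_cnj [measurable]: "cnj \<in> borel_measurable borel"
  by (intro borel_measurable_continuous_onI continuous_intros)

lemma L2_inner_integrable:
  assumes f: "f \<in> L2 M" and g: "g \<in> L2 M"
  shows "integrable M (\<lambda>x. f x * cnj (g x))"
proof -
  note [measurable] = f g
  show ?thesis
  proof (rule Bochner_Integration.integrable_bound[OF integrable_norm_mult_L2[OF f g]])
    show "(\<lambda>x. f x * cnj (g x)) \<in> borel_measurable M" by measurable
  qed (simp add: norm_mult)
qed

lemma L2_inner_bound:
  assumes f: "f \<in> L2 M" and g: "g \<in> L2 M"
  shows "cmod (L2_inner M f g) \<le> L2_norm M f * L2_norm M g"
proof -
  have "cmod (L2_inner M f g) \<le> (\<integral>x. cmod (f x) * cmod (g x) \<partial>M)"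
    unfolding L2_inner_def using integral_norm_bound[of M "\<lambda>x. f x * cnj (g x)"]
    by (simp add: norm_mult)
  with Cauchy_Schwarz_L2[OF f g] show ?thesis by linarith
qed

lemma
  assumes f: "f \<in> L2 M" and g: "g \<in> L2 M"
  shows L2_add: "(\<lambda>x. f x + g x) \<in> L2 M"
    and L2_norm_add: "L2_norm M (\<lambda>x. f x + g x) \<le> L2_norm M f + L2_norm M g"
proof -
  note [measurable] = f g
  let ?s = "\<lambda>x. (cmod (f x))\<^sup>2 + 2 * (cmod (f x) * cmod (g x)) + (cmod (g x))\<^sup>2"
  have le: "(cmod (f x + g x))\<^sup>2 \<le> ?s x" for x
    using power_mono[OF norm_triangle_ineq[of "f x" "g x"], of 2] by (simp add: power2_sum)
  have int: "integrable M ?s"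
    using L2_integrable[OF f] L2_integrable[OF g] integrable_norm_mult_L2[OF f g] by simp
  have int': "integrable M (\<lambda>x. (cmod (f x + g x))\<^sup>2)"
  proof (rule Bochner_Integration.integrable_bound[OF int])
    show "AE x in M. norm ((cmod (f x + g x))\<^sup>2) \<le> norm (?s x)"
      using le by (intro AE_I2) (simp add: abs_of_nonneg)
  qed measurable
  then show "(\<lambda>x. f x + g x) \<in> L2 M" by (simp add: L2_def)
  have "(L2_norm M (\<lambda>x. f x + g x))\<^sup>2 \<le> (\<integral>x. ?s x \<partial>M)"
    unfolding L2_norm_power2 by (rule integral_mono[OF int' int le])
  also have "\<dots> = (L2_norm M f)\<^sup>2 + 2 * (\<integral>x. cmod (f x) * cmod (g x) \<partial>M) + (L2_norm M g)\<^sup>2"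
    using L2_integrable[OF f] L2_integrable[OF g] integrable_norm_mult_L2[OF f g]
    by (simp add: L2_norm_power2)
  also have "\<dots> \<le> (L2_norm M f + L2_norm M g)\<^sup>2"
    using Cauchy_Schwarz_L2[OF f g] by (simp add: power2_sum)
  finally show "L2_norm M (\<lambda>x. f x + g x) \<le> L2_norm M f + L2_norm M g"
    by (rule power2_le_imp_le) simp
qed

lemma
  assumes f: "f \<in> L2 M"
  shows L2_scale: "(\<lambda>x. c * f x) \<in> L2 M"
    and L2_norm_scale: "L2_norm M (\<lambda>x. c * f x) \<le> cmod c * L2_norm M f"
proof -
  note [measurable] = f
  show "(\<lambda>x. c * f x) \<in> L2 M"
    by (rule L2_dominated[OF f, where B = "cmod c"]) (auto simp: norm_mult)
  show "L2_norm M (\<lambda>x. c * f x) \<le> cmod c * L2_norm M f"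
    by (rule L2_norm_dominated[OF f]) (auto simp: norm_mult)
qed

lemma
  assumes f: "f \<in> L2 M" and g: "g \<in> L2 M"
  shows L2_diff: "(\<lambda>x. f x - g x) \<in> L2 M"
    and L2_norm_diff: "L2_norm M (\<lambda>x. f x - g x) \<le> L2_norm M f + L2_norm M g"
proof -
  have "L2_norm M (\<lambda>x. f x + -1 * g x) \<le> L2_norm M f + L2_norm M (\<lambda>x. -1 * g x)"
    by (rule L2_norm_add[OF f L2_scale[OF g]])
  also have "\<dots> \<le> L2_norm M f + L2_norm M g"
    using L2_norm_scale[OF g, of "-1"] by simp
  finally show "L2_norm M (\<lambda>x. f x - g x) \<le> L2_norm M f + L2_norm M g" by simp
  show "(\<lambda>x. f x - g x) \<in> L2 M"
    using L2_add[OF f L2_scale[OF g, of "-1"]] by simp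
qed

lemma
  assumes f: "f \<in> L2 M" and g: "g \<in> L2 M" and h: "h \<in> L2 M"
  shows L2_inner_add: "L2_inner M (\<lambda>x. f x + g x) h = L2_inner M f h + L2_inner M g h"
    and L2_inner_diff: "L2_inner M (\<lambda>x. f x - g x) h = L2_inner M f h - L2_inner M g h"
  using L2_inner_integrable[OF f h] L2_inner_integrable[OF g h]
  by (simp_all add: L2_inner_def ring_distribs)

lemma L2_inner_scale: "L2_inner M (\<lambda>x. c * f x) h = c * L2_inner M f h"
  by (simp add: L2_inner_def mult.assoc)

lemma L2_inner_cong_AE:
  assumes "f \<in> borel_measurable M" "g \<in> borel_measurable M" "h \<in> borel_measurable M"
    and "AE x in M. f x = g x"
  shows "L2_inner M f h = L2_inner M g h"
proof -
  note [measurable] = assms(1-3)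
  show ?thesis
    unfolding L2_inner_def by (rule integral_cong_AE) (use assms(4) in auto)
qed

lemma L2_norm_cong_AE:
  assumes "f \<in> borel_measurable M" "g \<in> borel_measurable M"
    and "AE x in M. f x = g x"
  shows "L2_norm M f = L2_norm M g"
  unfolding L2_norm_def using assms by (intro arg_cong[where f = sqrt] integral_cong_AE) auto

lemma L2_norm_eq_0_imp:
  assumes "f \<in> L2 M" "L2_norm M f = 0"
  shows "AE x in M. f x = 0"
proof -
  have "(\<integral>x. (cmod (f x))\<^sup>2 \<partial>M) = 0"
    using assms(2) L2_norm_power2[of M f] by simp
  then show ?thesis
    using integral_nonneg_eq_0_iff_AE[OF L2_integrable[OF assms(1)]] by simp
qed

section \<open>Purely atomic measures\<close>

lemma sets_atomic_measure [measurable_cong, simp]: "sets (atomic_measure w p) = sets borel"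
  by (simp add: atomic_measure_def)

lemma space_atomic_measure [simp]: "space (atomic_measure w p) = UNIV"
  by (simp add: atomic_measure_def)

lemma borel_measurable_atomic_measure [simp]:
  "borel_measurable (atomic_measure w p) = borel_measurable borel"
  by (rule measurable_cong_sets) auto

text \<open>
  Every point \<open>p n\<close> carries positive mass, so a null set contains none of them; and the countable
  set of these points has a null complement.  Almost everywhere thus means at every atom.
\<close>

lemma AE_atomic_measure_iff:
  assumes "\<forall>n. 0 < w n"
  shows "(AE x in atomic_measure w p. P x) \<longleftrightarrow> (\<forall>n. P (p n))"
proof -
  have w_meas: "(\<lambda>n. ennreal (w n)) \<in> borel_measurable (count_space UNIV)" by simp
  have point: "(AE n in point_measure UNIV (\<lambda>n. ennreal (w n)). Q n) \<longleftrightarrow> (\<forall>n. Q n)" for Q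
    unfolding point_measure_def AE_density[OF w_meas] AE_count_space using assms by simp
  have meas: "p \<in> measurable (point_measure UNIV (\<lambda>n. ennreal (w n))) borel"
    by (simp add: point_measure_def)
  show ?thesis
  proof
    assume "AE x in atomic_measure w p. P x"
    then have "AE n in point_measure UNIV (\<lambda>n. ennreal (w n)). P (p n)"
      unfolding atomic_measure_def by (rule AE_distrD[OF meas])
    then show "\<forall>n. P (p n)" by (rule point[THEN iffD1])
  next
    assume P: "\<forall>n. P (p n)"
    have meas_range: "{x \<in> space borel. x \<in> range p} \<in> sets borel"
      using sets.countable[of "range p" borel] by simp
    have "AE n in point_measure UNIV (\<lambda>n. ennreal (w n)). p n \<in> range p"
      by (rule AE_I2) (rule rangeI)
    then have "AE x in atomic_measure w p. x \<in> range p"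
      unfolding atomic_measure_def AE_distr_iff[OF meas meas_range] .
    then show "AE x in atomic_measure w p. P x"
    proof eventually_elim
      case (elim x)
      then obtain n where "x = p n" by (rule rangeE)
      then show "P x" using P by simp
    qed
  qed
qed

lemma
  fixes f :: "real \<Rightarrow> 'b::{banach, second_countable_topology}"
  assumes w: "\<forall>n. 0 < w n" and f: "f \<in> borel_measurable borel"
  shows integrable_atomic_measure_iff:
      "integrable (atomic_measure w p) f \<longleftrightarrow> summable (\<lambda>n. w n * norm (f (p n)))"
    and integral_atomic_measure:
      "integrable (atomic_measure w p) f \<Longrightarrow>
        integral\<^sup>L (atomic_measure w p) f = (\<Sum>n. w n *\<^sub>R f (p n))"
proof -
  let ?D = "density (count_space UNIV) (\<lambda>n. ennreal (w n))"
  have meas: "p \<in> measurable ?D borel" and w_meas: "w \<in> borel_measurable (count_space UNIV)"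
    and fp: "(\<lambda>n. f (p n)) \<in> borel_measurable (count_space UNIV)"
    by simp_all
  have ae: "AE n in count_space UNIV. 0 \<le> w n"
    using w by (simp add: AE_count_space less_imp_le)
  have dist: "atomic_measure w p = distr ?D borel p"
    by (simp only: atomic_measure_def point_measure_def)
  have *: "integrable (atomic_measure w p) f \<longleftrightarrow> integrable (count_space UNIV) (\<lambda>n. w n *\<^sub>R f (p n))"
    unfolding dist integrable_distr_eq[OF meas f] by (rule integrable_density[OF fp w_meas ae])
  have **: "integral\<^sup>L (atomic_measure w p) f = (\<integral>n. w n *\<^sub>R f (p n) \<partial>count_space UNIV)"
    unfolding dist integral_distr[OF meas f] by (rule integral_density[OF fp w_meas ae])
  have "norm (w n *\<^sub>R f (p n)) = w n * norm (f (p n))" for n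
    using w by (simp add: less_imp_le)
  then show "integrable (atomic_measure w p) f \<longleftrightarrow> summable (\<lambda>n. w n * norm (f (p n)))"
    by (simp only: * integrable_count_space_nat_iff)
  show "integral\<^sup>L (atomic_measure w p) f = (\<Sum>n. w n *\<^sub>R f (p n))"
    if "integrable (atomic_measure w p) f"
    using that unfolding * ** by (rule integral_count_space_nat)
qed

lemma L2_atomic_measure_iff:
  assumes "\<forall>n. 0 < w n"
  shows "f \<in> L2 (atomic_measure w p) \<longleftrightarrow>
    f \<in> borel_measurable borel \<and> summable (\<lambda>n. w n * (cmod (f (p n)))\<^sup>2)"
proof -
  have "integrable (atomic_measure w p) (\<lambda>x. (cmod (f x))\<^sup>2) \<longleftrightarrow>
      summable (\<lambda>n. w n * (cmod (f (p n)))\<^sup>2)" if "f \<in> borel_measurable borel"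
    using integrable_atomic_measure_iff[OF assms, of "\<lambda>x. (cmod (f x))\<^sup>2" p] that by simp
  then show ?thesis
    unfolding L2_def borel_measurable_atomic_measure mem_Collect_eq by blast
qed

lemma L2_norm_atom:
  assumes w: "\<forall>n. 0 < w n" and f: "f \<in> L2 (atomic_measure w p)"
  shows "cmod (f (p n)) \<le> L2_norm (atomic_measure w p) f / sqrt (w n)"
proof -
  let ?q = "\<lambda>n. w n * (cmod (f (p n)))\<^sup>2"
  have meas: "(\<lambda>x. (cmod (f x))\<^sup>2) \<in> borel_measurable borel"
    using L2_measurable[OF f] by simp
  have sum: "summable ?q"
    using f w by (simp add: L2_atomic_measure_iff)
  have "?q n \<le> (\<Sum>n. ?q n)"
    using sum_le_suminf[OF sum, of "{n}"] w by (simp add: less_imp_le)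
  also have "(\<Sum>n. ?q n) = (L2_norm (atomic_measure w p) f)\<^sup>2"
    using integral_atomic_measure[OF w meas L2_integrable[OF f]] by (simp add: L2_norm_power2)
  finally have "(cmod (f (p n)) * sqrt (w n))\<^sup>2 \<le> (L2_norm (atomic_measure w p) f)\<^sup>2"
    using w by (simp add: power_mult_distrib less_imp_le mult.commute)
  then have "cmod (f (p n)) * sqrt (w n) \<le> L2_norm (atomic_measure w p) f"
    by (rule power2_le_imp_le) simp
  then show ?thesis
    using w by (simp add: pos_le_divide_eq)
qed

lemma
  assumes w: "\<forall>n. 0 < w n" and p: "inj p" and b: "b \<in> borel_measurable borel"
  shows indicator_atom_L2: "(indicator {p m} :: real \<Rightarrow> complex) \<in> L2 (atomic_measure w p)"
    and L2_inner_indicator_atom: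
      "L2_inner (atomic_measure w p) (indicator {p m}) b = of_real (w m) * cnj (b (p m))"
proof -
  have single: "indicator {p m} (p n) = (if n = m then 1 else 0 :: complex)" for n
    using p by (auto simp: indicator_def inj_def)
  have "summable (\<lambda>n. w n * (cmod (indicator {p m} (p n)))\<^sup>2)"
    by (rule summable_finite[of "{m}"]) (auto simp: single)
  then show ind: "(indicator {p m} :: real \<Rightarrow> complex) \<in> L2 (atomic_measure w p)"
    using w by (simp add: L2_atomic_measure_iff)
  note [measurable] = b
  have meas: "(\<lambda>x. indicator {p m} x * cnj (b x)) \<in> borel_measurable borel"
    by measurable
  have "integrable (atomic_measure w p) (\<lambda>x. indicator {p m} x * cnj (b x))"
    unfolding integrable_atomic_measure_iff[OF w meas]
    by (rule summable_finite[of "{m}"]) (auto simp: single)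
  then have "L2_inner (atomic_measure w p) (indicator {p m}) b =
      (\<Sum>n. w n *\<^sub>R (indicator {p m} (p n) * cnj (b (p n))))"
    unfolding L2_inner_def by (rule integral_atomic_measure[OF w meas])
  also have "\<dots> = (\<Sum>n\<in>{m}. w n *\<^sub>R (indicator {p m} (p n) * cnj (b (p n))))"
    by (rule suminf_finite) (auto simp: single)
  finally show "L2_inner (atomic_measure w p) (indicator {p m}) b = of_real (w m) * cnj (b (p m))"
    by (simp add: scaleR_conv_of_real)
qed

section \<open>The resolvent of a rank one perturbation\<close>

text \<open>
  The lower bound, applied to differences, already forces injectivity, because the perturbed operator
  is linear and everywhere defined when multiplication by \<open>x\<close> is.
\<close>

lemma rank_one_resolventI:
  assumes a: "a \<in> L2 M" and b: "b \<in> L2 M"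
    and dom: "\<And>f. f \<in> L2 M \<Longrightarrow> (\<lambda>x. of_real x * f x) \<in> L2 M"
    and bound: "\<And>f. f \<in> L2 M \<Longrightarrow>
      L2_norm M f \<le> C * L2_norm M (\<lambda>x. of_real x * f x + L2_inner M f b * a x - \<zeta> * f x)"
    and surj: "\<And>h. h \<in> L2 M \<Longrightarrow>
      \<exists>f\<in>L2 M. AE x in M. of_real x * f x + L2_inner M f b * a x - \<zeta> * f x = h x"
  shows "\<zeta> \<in> resolvent_set M (rank_one_perturbation M a b)"
proof -
  let ?T = "\<lambda>f x. of_real x * f x + L2_inner M f b * a x - \<zeta> * f x"
  have dom_eq: "mult_domain M = L2 M"
    using dom by (auto simp: mult_domain_def)
  have meas: "?T f \<in> borel_measurable M" if "f \<in> L2 M" for f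
  proof -
    have "(\<lambda>x. of_real x * f x + L2_inner M f b * a x) \<in> L2 M"
      by (intro L2_add L2_scale dom that a)
    then show ?thesis
      by (intro L2_measurable L2_diff L2_scale that)
  qed
  have inj: "AE x in M. f x = f' x"
    if f: "f \<in> L2 M" and f': "f' \<in> L2 M" and eq: "AE x in M. ?T f x = ?T f' x" for f f'
  proof -
    let ?d = "\<lambda>x. f x - f' x"
    have d: "?d \<in> L2 M" by (rule L2_diff[OF f f'])
    have "?T ?d x = ?T f x - ?T f' x" for x
      by (simp add: L2_inner_diff[OF f f' b] algebra_simps)
    then have "AE x in M. ?T ?d x = 0" using eq by simp
    then have "L2_norm M (?T ?d) = L2_norm M (\<lambda>x. 0)"
      by (rule L2_norm_cong_AE[OF meas[OF d] borel_measurable_const])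
    then have "L2_norm M ?d = 0"
      using bound[OF d] L2_norm_nonneg[of M ?d] by (simp add: L2_norm_def[of M "\<lambda>x. 0"])
    then have "AE x in M. ?d x = 0" by (rule L2_norm_eq_0_imp[OF d])
    then show ?thesis by simp
  qed
  show ?thesis
    unfolding resolvent_set_def rank_one_perturbation_def dom_eq mem_Collect_eq
  proof (intro conjI)
    show "\<exists>C. \<forall>(f, g) \<in> {(f, \<lambda>x. of_real x * f x + L2_inner M f b * a x) | f. f \<in> L2 M}.
        L2_norm M f \<le> C * L2_norm M (\<lambda>x. g x - \<zeta> * f x)"
      by (intro exI[of _ C]) (clarsimp simp: bound)
    show "\<forall>h\<in>L2 M. \<exists>(f, g)\<in>{(f, \<lambda>x. of_real x * f x + L2_inner M f b * a x) | f. f \<in> L2 M}.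
        AE x in M. g x - \<zeta> * f x = h x"
    proof
      fix h assume "h \<in> L2 M"
      from surj[OF this] obtain f where "f \<in> L2 M" "AE x in M. ?T f x = h x" by blast
      then show "\<exists>(f, g)\<in>{(f, \<lambda>x. of_real x * f x + L2_inner M f b * a x) | f. f \<in> L2 M}.
          AE x in M. g x - \<zeta> * f x = h x"
        by (intro bexI[of _ "(f, \<lambda>x. of_real x * f x + L2_inner M f b * a x)"]) auto
    qed
  qed (clarsimp simp: inj)
qed

text \<open>
  A nonzero \<open>\<zeta>\<close> keeps its distance from the tail of a null sequence, and only finitely many terms
  remain.  Terms equal to \<open>\<zeta>\<close> are left out, so that the bound serves both for \<open>\<zeta>\<close> off the
  sequence and for \<open>\<zeta>\<close> on it.
\<close>

lemma null_sequence_gap: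
  fixes p :: "nat \<Rightarrow> real" and \<zeta> :: complex
  assumes p: "p \<longlonglongrightarrow> 0" and \<zeta>: "\<zeta> \<noteq> 0"
  obtains \<delta> where "0 < \<delta>" "\<And>n. of_real (p n) \<noteq> \<zeta> \<Longrightarrow> \<delta> \<le> cmod (of_real (p n) - \<zeta>)"
proof -
  obtain N where N: "\<And>n. n \<ge> N \<Longrightarrow> \<bar>p n\<bar> < cmod \<zeta> / 2"
    using LIMSEQ_D[OF p, of "cmod \<zeta> / 2"] \<zeta> by auto
  define D where "D = insert (cmod \<zeta> / 2)
    ((\<lambda>n. cmod (of_real (p n) - \<zeta>)) ` {n. n < N \<and> of_real (p n) \<noteq> \<zeta>})"
  have fin: "finite D" and ne: "D \<noteq> {}" by (simp_all add: D_def)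
  have "\<forall>d\<in>D. 0 < d" using \<zeta> by (simp add: D_def)
  then have "0 < Min D" using fin ne by simp
  moreover have "Min D \<le> cmod (of_real (p n) - \<zeta>)" if "of_real (p n) \<noteq> \<zeta>" for n
  proof (cases "n < N")
    case True
    then show ?thesis using that fin by (intro Min_le) (auto simp: D_def)
  next
    case False
    have "Min D \<le> cmod \<zeta> / 2" using fin by (intro Min_le) (auto simp: D_def)
    also have "\<dots> \<le> cmod \<zeta> - cmod (of_real (p n))" using N[of n] False by simp
    also have "\<dots> \<le> cmod (of_real (p n) - \<zeta>)"
      by (metis norm_minus_commute norm_triangle_ineq2)
    finally show ?thesis .
  qed
  ultimately show thesis by (rule that)
qed

locale compact_multiplication =
  fixes w p :: "nat \<Rightarrow> real"
  assumes w_pos: "\<forall>n. 0 < w n" and inj_p: "inj p" and p_null: "p \<longlonglongrightarrow> 0"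
begin

abbreviation M where "M \<equiv> atomic_measure w p"

lemma AE_M_iff: "(AE x in M. P x) \<longleftrightarrow> (\<forall>n. P (p n))"
  by (rule AE_atomic_measure_iff[OF w_pos])

lemma L2_borel [measurable_dest]: "f \<in> L2 M \<Longrightarrow> f \<in> borel_measurable borel"
  using L2_measurable[of f M] by simp

lemma p_bounded: obtains B where "\<And>n. \<bar>p n\<bar> \<le> B"
proof -
  have "Bseq p" by (rule convergent_imp_Bseq[OF convergentI[OF p_null]])
  then obtain B where "\<forall>n. norm (p n) \<le> B" by (rule BseqE)
  then show thesis using that[of B] by simp
qed

lemma mult_L2:
  assumes f: "f \<in> L2 M"
  shows "(\<lambda>x. of_real x * f x) \<in> L2 M"
proof -
  note [measurable] = L2_borel[OF f]
  obtain B where B: "\<And>n. \<bar>p n\<bar> \<le> B" by (rule p_bounded) blast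
  show ?thesis
  proof (rule L2_dominated[OF f, where B = B])
    show "0 \<le> B" using B[of 0] by linarith
    show "AE x in M. cmod (of_real x * f x) \<le> B * cmod (f x)"
      by (simp add: AE_M_iff norm_mult B mult_right_mono)
  qed simp
qed

text \<open>
  Division by \<open>x - \<zeta>\<close> annihilates the value at \<open>\<zeta>\<close>, since \<open>y / 0 = 0\<close>; it is therefore bounded even
  when \<open>\<zeta>\<close> is one of the atoms.
\<close>

lemma division_bounded:
  assumes \<zeta>: "\<zeta> \<noteq> 0"
  obtains B where "0 \<le> B"
    "\<And>f. f \<in> L2 M \<Longrightarrow> (\<lambda>x. f x / (of_real x - \<zeta>)) \<in> L2 M"
    "\<And>f. f \<in> L2 M \<Longrightarrow> L2_norm M (\<lambda>x. f x / (of_real x - \<zeta>)) \<le> B * L2_norm M f"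
proof -
  obtain \<delta> where \<delta>: "0 < \<delta>" "\<And>n. of_real (p n) \<noteq> \<zeta> \<Longrightarrow> \<delta> \<le> cmod (of_real (p n) - \<zeta>)"
    using null_sequence_gap[OF p_null \<zeta>] by blast
  have ae: "AE x in M. cmod (f x / (of_real x - \<zeta>)) \<le> 1 / \<delta> * cmod (f x)" for f
    unfolding AE_M_iff
  proof
    fix n
    show "cmod (f (p n) / (of_real (p n) - \<zeta>)) \<le> 1 / \<delta> * cmod (f (p n))"
    proof (cases "of_real (p n) = \<zeta>")
      case True
      then show ?thesis using \<delta>(1) by simp
    next
      case False
      then show ?thesis
        using \<delta>(1) \<delta>(2)[of n] frac_le[of "cmod (f (p n))" "cmod (f (p n))" \<delta>]
        by (simp add: norm_divide)
    qed
  qed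
  have meas: "(\<lambda>x. f x / (of_real x - \<zeta>)) \<in> borel_measurable M" if f: "f \<in> L2 M" for f
  proof -
    note [measurable] = L2_borel[OF f]
    show ?thesis unfolding borel_measurable_atomic_measure by measurable
  qed
  show thesis
  proof (rule that[of "1 / \<delta>"])
    show "0 \<le> 1 / \<delta>" using \<delta>(1) by simp
    show "(\<lambda>x. f x / (of_real x - \<zeta>)) \<in> L2 M" if "f \<in> L2 M" for f
      by (rule L2_dominated[OF that meas[OF that] ae]) (use \<delta>(1) in simp)
    show "L2_norm M (\<lambda>x. f x / (of_real x - \<zeta>)) \<le> 1 / \<delta> * L2_norm M f" if "f \<in> L2 M" for f
      by (rule L2_norm_dominated[OF that meas[OF that] ae]) (use \<delta>(1) in simp)
  qed
qed

text \<open>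
  Write \<open>R\<close> for division by \<open>x - \<zeta>\<close> and \<open>k = (f, b)\<close>.  The equation \<open>(x - \<zeta>) f + k a = h\<close> says
  \<open>f = R h - k R a\<close>; pairing with \<open>b\<close> turns it into \<open>k (1 + (R a, b)) = (R h, b)\<close>, a scalar equation
  that determines \<open>k\<close> by \<open>h\<close> when its coefficient is nonzero.
\<close>

lemma rank_one_resolvent_off_atoms:
  assumes a: "a \<in> L2 M" and b: "b \<in> L2 M"
    and \<zeta>: "\<zeta> \<noteq> 0" "\<And>n. of_real (p n) \<noteq> \<zeta>"
    and nz: "1 + L2_inner M (\<lambda>x. a x / (of_real x - \<zeta>)) b \<noteq> 0"
  shows "\<zeta> \<in> resolvent_set M (rank_one_perturbation M a b)"
proof -
  define R where "R f = (\<lambda>x. f x / (of_real x - \<zeta>))" for f :: "real \<Rightarrow> complex"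
  obtain B where B: "0 \<le> B" "\<And>f. f \<in> L2 M \<Longrightarrow> R f \<in> L2 M"
    "\<And>f. f \<in> L2 M \<Longrightarrow> L2_norm M (R f) \<le> B * L2_norm M f"
    using division_bounded[OF \<zeta>(1)] unfolding R_def by blast
  define \<phi> where "\<phi> = 1 + L2_inner M (R a) b"
  have \<phi>: "\<phi> \<noteq> 0" using nz by (simp add: \<phi>_def R_def)
  have Ra: "L2_inner M (R a) b = \<phi> - 1" by (simp add: \<phi>_def)
  have Ra_mem: "(\<lambda>x. k * R a x) \<in> L2 M" for k by (rule L2_scale[OF B(2)[OF a]])
  have inner_kRa: "L2_inner M (\<lambda>x. k * R a x) b = k * (\<phi> - 1)" for k
    by (simp add: L2_inner_scale Ra)
  have inner_bound: "cmod (L2_inner M (R h) b) \<le> B * L2_norm M h * L2_norm M b" if "h \<in> L2 M" for h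
    using L2_inner_bound[OF B(2)[OF that] b] mult_right_mono[OF B(3)[OF that] L2_norm_nonneg[of M b]]
    by linarith
  show ?thesis
  proof (rule rank_one_resolventI[OF a b mult_L2])
    fix f assume f: "f \<in> L2 M"
    define h where "h = (\<lambda>x. of_real x * f x + L2_inner M f b * a x - \<zeta> * f x)"
    define k where "k = L2_inner M f b"
    have h: "h \<in> L2 M"
      unfolding h_def by (intro L2_diff L2_add L2_scale mult_L2 f a)
    have Rh: "AE x in M. R h x = f x + k * R a x"
      unfolding AE_M_iff
    proof
      fix n
      have "of_real (p n) - \<zeta> \<noteq> 0" using \<zeta>(2)[of n] by simp
      then show "R h (p n) = f (p n) + k * R a (p n)"
        by (simp add: R_def h_def k_def field_simps)
    qed
    have sum_mem: "(\<lambda>x. f x + k * R a x) \<in> L2 M" by (rule L2_add[OF f Ra_mem])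
    have "L2_inner M (R h) b = L2_inner M (\<lambda>x. f x + k * R a x) b"
      by (rule L2_inner_cong_AE[OF L2_measurable[OF B(2)[OF h]] L2_measurable[OF sum_mem]
          L2_measurable[OF b] Rh])
    also have "\<dots> = k * \<phi>"
      by (simp add: L2_inner_add[OF f Ra_mem b] inner_kRa flip: k_def) (simp add: algebra_simps)
    finally have k: "k = L2_inner M (R h) b / \<phi>" using \<phi> by simp
    have diff_mem: "(\<lambda>x. R h x - k * R a x) \<in> L2 M" by (rule L2_diff[OF B(2)[OF h] Ra_mem])
    have "AE x in M. f x = R h x - k * R a x"
      using Rh by eventually_elim simp
    then have "L2_norm M f = L2_norm M (\<lambda>x. R h x - k * R a x)"
      by (rule L2_norm_cong_AE[OF L2_measurable[OF f] L2_measurable[OF diff_mem]])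
    also have "\<dots> \<le> L2_norm M (R h) + L2_norm M (\<lambda>x. k * R a x)"
      by (rule L2_norm_diff[OF B(2)[OF h] Ra_mem])
    also have "\<dots> \<le> B * L2_norm M h + cmod k * L2_norm M (R a)"
      by (rule add_mono[OF B(3)[OF h] L2_norm_scale[OF B(2)[OF a]]])
    also have "cmod k * L2_norm M (R a) \<le>
        (B * L2_norm M h * L2_norm M b / cmod \<phi>) * L2_norm M (R a)"
      unfolding k norm_divide
      by (intro mult_right_mono divide_right_mono inner_bound h L2_norm_nonneg norm_ge_zero)
    also have "B * L2_norm M h + (B * L2_norm M h * L2_norm M b / cmod \<phi>) * L2_norm M (R a) =
        (B + B * L2_norm M b / cmod \<phi> * L2_norm M (R a)) * L2_norm M h"
      by (simp add: algebra_simps)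
    finally show "L2_norm M f \<le> (B + B * L2_norm M b / cmod \<phi> * L2_norm M (R a)) *
        L2_norm M (\<lambda>x. of_real x * f x + L2_inner M f b * a x - \<zeta> * f x)"
      by (simp add: h_def)
  next
    fix h assume h: "h \<in> L2 M"
    define k where "k = L2_inner M (R h) b / \<phi>"
    define f where "f = (\<lambda>x. R h x - k * R a x)"
    have f: "f \<in> L2 M" unfolding f_def by (rule L2_diff[OF B(2)[OF h] Ra_mem])
    have k: "L2_inner M f b = k"
      using \<phi> unfolding f_def L2_inner_diff[OF B(2)[OF h] Ra_mem b] inner_kRa
      by (simp add: k_def field_simps)
    have "of_real (p n) * f (p n) + k * a (p n) - \<zeta> * f (p n) = h (p n)" for n
    proof -
      have ne: "of_real (p n) - \<zeta> \<noteq> 0" using \<zeta>(2)[of n] by simp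
      have "of_real (p n) * f (p n) + k * a (p n) - \<zeta> * f (p n) =
          (of_real (p n) - \<zeta>) * f (p n) + k * a (p n)" by (simp add: algebra_simps)
      also have "(of_real (p n) - \<zeta>) * f (p n) = h (p n) - k * a (p n)"
        using ne by (simp add: f_def R_def right_diff_distrib)
      finally show ?thesis by simp
    qed
    then show "\<exists>f\<in>L2 M. AE x in M. of_real x * f x + L2_inner M f b * a x - \<zeta> * f x = h x"
      using f k by (intro bexI[of _ f]) (simp_all add: AE_M_iff)
  qed
qed

text \<open>
  At an atom \<open>c = p m\<close> the equation \<open>(x - c) f + k a = h\<close> with \<open>k = (f, b)\<close> reads \<open>k a(c) = h(c)\<close> at
  the point \<open>c\<close>, which fixes \<open>k\<close>.  Away from \<open>c\<close> it determines \<open>f\<close>, and the remaining unknown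
  \<open>f(c)\<close> is used to give the pairing \<open>(f, b)\<close> the value \<open>k\<close>; this is possible as \<open>b(c) \<noteq> 0\<close>.
\<close>

lemma rank_one_resolvent_at_atom:
  assumes a: "a \<in> L2 M" and b: "b \<in> L2 M"
    and pm: "p m \<noteq> 0" and am: "a (p m) \<noteq> 0" and bm: "b (p m) \<noteq> 0"
  shows "of_real (p m) \<in> resolvent_set M (rank_one_perturbation M a b)"
proof -
  define c where "c = p m"
  define \<zeta> where "\<zeta> = complex_of_real c"
  have \<zeta>: "\<zeta> \<noteq> 0" using pm by (simp add: \<zeta>_def c_def)
  define R where "R f = (\<lambda>x. f x / (of_real x - \<zeta>))" for f :: "real \<Rightarrow> complex"
  obtain B where B: "0 \<le> B" "\<And>f. f \<in> L2 M \<Longrightarrow> R f \<in> L2 M"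
    "\<And>f. f \<in> L2 M \<Longrightarrow> L2_norm M (R f) \<le> B * L2_norm M f"
    using division_bounded[OF \<zeta>] unfolding R_def by blast
  define e :: "real \<Rightarrow> complex" where "e = indicator {c}"
  have e: "e \<in> L2 M"
    unfolding e_def c_def by (rule indicator_atom_L2[OF w_pos inj_p L2_borel[OF b]])
  define E where "E = L2_inner M e b"
  have "w m \<noteq> 0" using w_pos by (metis less_irrefl)
  then have E: "E \<noteq> 0"
    using bm by (simp add: E_def e_def c_def L2_inner_indicator_atom[OF w_pos inj_p L2_borel[OF b]])
  define K where "K = 1 / (sqrt (w m) * cmod (a c))"
  define G where "G = L2_inner M (R a) b"
  let ?na = "L2_norm M (R a)" and ?nb = "L2_norm M b" and ?ne = "L2_norm M e"
  have Ra_mem: "(\<lambda>x. k * R a x) \<in> L2 M" for k by (rule L2_scale[OF B(2)[OF a]])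
  have e_mem: "(\<lambda>x. k * e x) \<in> L2 M" for k by (rule L2_scale[OF e])
  have inner_bound: "cmod (L2_inner M (R h) b) \<le> B * L2_norm M h * ?nb" if "h \<in> L2 M" for h
    using L2_inner_bound[OF B(2)[OF that] b] mult_right_mono[OF B(3)[OF that] L2_norm_nonneg[of M b]]
    by linarith
  have "\<zeta> \<in> resolvent_set M (rank_one_perturbation M a b)"
  proof (rule rank_one_resolventI[OF a b mult_L2])
    fix f assume f: "f \<in> L2 M"
    define h where "h = (\<lambda>x. of_real x * f x + L2_inner M f b * a x - \<zeta> * f x)"
    define k where "k = L2_inner M f b"
    let ?nh = "L2_norm M h"
    have h: "h \<in> L2 M"
      unfolding h_def by (intro L2_diff L2_add L2_scale mult_L2 f a)
    have "h c = k * a c" by (simp add: h_def k_def \<zeta>_def)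
    then have "cmod k * cmod (a c) \<le> ?nh / sqrt (w m)"
      using L2_norm_atom[OF w_pos h, of m] by (simp add: c_def norm_mult)
    then have k: "cmod k \<le> K * ?nh"
      using am by (simp add: K_def c_def pos_le_divide_eq divide_divide_eq_left[symmetric] del: divide_divide_eq_left)
    have f_eq: "f = (\<lambda>x. (R h x - k * R a x) + f c * e x)"
    proof (rule ext, goal_cases)
      case (1 x)
      show ?case
      proof (cases "x = c")
        case True
        then show ?thesis by (simp add: R_def \<zeta>_def e_def)
      next
        case False
        then have "of_real x - \<zeta> \<noteq> 0" by (simp add: \<zeta>_def)
        moreover have "h x = (of_real x - \<zeta>) * f x + k * a x"
          by (simp add: h_def k_def algebra_simps)
        ultimately have "R h x = f x + k * R a x"
          by (simp add: R_def add_divide_distrib)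
        then show ?thesis using False by (simp add: e_def)
      qed
    qed
    have diff_mem: "(\<lambda>x. R h x - k * R a x) \<in> L2 M" by (rule L2_diff[OF B(2)[OF h] Ra_mem])
    have "k = L2_inner M f b" by (rule k_def)
    also have "\<dots> = L2_inner M (\<lambda>x. (R h x - k * R a x) + f c * e x) b"
      by (rule arg_cong[where f = "\<lambda>g. L2_inner M g b", OF f_eq])
    also have "\<dots> = L2_inner M (R h) b - k * G + f c * E"
      unfolding L2_inner_add[OF diff_mem e_mem b] L2_inner_diff[OF B(2)[OF h] Ra_mem b]
        L2_inner_scale E_def G_def by simp
    finally have fc: "f c = (k * (1 + G) - L2_inner M (R h) b) / E"
      using E by (simp add: field_simps)
    have "cmod (f c) \<le> (cmod k * cmod (1 + G) + cmod (L2_inner M (R h) b)) / cmod E"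
      unfolding fc norm_divide norm_mult[symmetric]
      by (intro divide_right_mono norm_triangle_ineq4 norm_ge_zero)
    also have "\<dots> \<le> (K * ?nh * cmod (1 + G) + B * ?nh * ?nb) / cmod E"
      by (intro divide_right_mono add_mono mult_right_mono k inner_bound h norm_ge_zero)
    finally have fc_le: "cmod (f c) \<le> (K * ?nh * cmod (1 + G) + B * ?nh * ?nb) / cmod E" .
    have "L2_norm M f = L2_norm M (\<lambda>x. (R h x - k * R a x) + f c * e x)"
      by (rule arg_cong[where f = "L2_norm M", OF f_eq])
    also have "\<dots> \<le> (L2_norm M (R h) + L2_norm M (\<lambda>x. k * R a x)) + L2_norm M (\<lambda>x. f c * e x)"
      by (rule order_trans[OF L2_norm_add[OF diff_mem e_mem]
            add_right_mono[OF L2_norm_diff[OF B(2)[OF h] Ra_mem]]])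
    also have "\<dots> \<le> (B * ?nh + cmod k * ?na) + cmod (f c) * ?ne"
      by (intro add_mono B(3) h L2_norm_scale B(2) a e)
    also have "\<dots> \<le> (B * ?nh + K * ?nh * ?na) +
        (K * ?nh * cmod (1 + G) + B * ?nh * ?nb) / cmod E * ?ne"
      by (intro add_mono mult_right_mono k fc_le L2_norm_nonneg order_refl)
    also have "\<dots> = (B + K * ?na + (K * cmod (1 + G) + B * ?nb) / cmod E * ?ne) * ?nh"
      by (simp add: algebra_simps add_divide_distrib)
    finally show "L2_norm M f \<le> (B + K * ?na + (K * cmod (1 + G) + B * ?nb) / cmod E * ?ne) *
        L2_norm M (\<lambda>x. of_real x * f x + L2_inner M f b * a x - \<zeta> * f x)"
      by (simp add: h_def)
  next
    fix h assume h: "h \<in> L2 M"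
    define k where "k = h c / a c"
    define u where "u = (\<lambda>x. R h x - k * R a x)"
    define g where "g = (k - L2_inner M u b) / E"
    define f where "f = (\<lambda>x. u x + g * e x)"
    have u: "u \<in> L2 M" unfolding u_def by (rule L2_diff[OF B(2)[OF h] Ra_mem])
    have f: "f \<in> L2 M" unfolding f_def by (rule L2_add[OF u e_mem])
    have k: "L2_inner M f b = k"
      using E unfolding f_def L2_inner_add[OF u e_mem b] L2_inner_scale E_def[symmetric]
      by (simp add: g_def)
    have "of_real x * f x + k * a x - \<zeta> * f x = h x" for x
    proof (cases "x = c")
      case True
      then show ?thesis using am by (simp add: \<zeta>_def k_def c_def)
    next
      case False
      then have ne: "of_real x - \<zeta> \<noteq> 0" by (simp add: \<zeta>_def)
      have "of_real x * f x + k * a x - \<zeta> * f x = (of_real x - \<zeta>) * f x + k * a x"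
        by (simp add: algebra_simps)
      also have "(of_real x - \<zeta>) * f x = h x - k * a x"
        using ne False by (simp add: f_def u_def e_def R_def right_diff_distrib)
      finally show ?thesis by simp
    qed
    then show "\<exists>f\<in>L2 M. AE x in M. of_real x * f x + L2_inner M f b * a x - \<zeta> * f x = h x"
      using f k by (intro bexI[of _ f]) (simp_all add: AE_M_iff)
  qed
  then show ?thesis by (simp add: \<zeta>_def c_def)
qed

text \<open>
  Two consecutive atoms support a nonzero \<open>f\<close> orthogonal to \<open>b\<close>.  On such \<open>f\<close> the perturbation
  vanishes, and multiplication by \<open>x\<close> shrinks the norm as much as desired far along the sequence of
  atoms.  The perturbed operator is therefore not bounded below.
\<close>

lemma zero_in_spectrum:
  assumes b: "b \<in> L2 M" and b_nz: "\<And>n. b (p n) \<noteq> 0"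
  shows "0 \<in> spectrum M (rank_one_perturbation M a b)"
proof -
  have False if "0 \<in> resolvent_set M (rank_one_perturbation M a b)"
  proof -
    obtain C where C: "\<And>f. f \<in> L2 M \<Longrightarrow>
        L2_norm M f \<le> C * L2_norm M (\<lambda>x. of_real x * f x + L2_inner M f b * a x)"
    proof -
      from \<open>0 \<in> resolvent_set M _\<close> obtain C where C: "\<forall>(f, g) \<in> rank_one_perturbation M a b.
          L2_norm M f \<le> C * L2_norm M (\<lambda>x. g x - 0 * f x)"
        unfolding resolvent_set_def by blast
      have "L2_norm M f \<le> C * L2_norm M (\<lambda>x. of_real x * f x + L2_inner M f b * a x)"
        if f: "f \<in> L2 M" for f
      proof -
        have "f \<in> mult_domain M"
          using f mult_L2[OF f] by (simp add: mult_domain_def)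
        then have "(f, \<lambda>x. of_real x * f x + L2_inner M f b * a x) \<in> rank_one_perturbation M a b"
          unfolding rank_one_perturbation_def by blast
        from bspec[OF C this] show ?thesis by simp
      qed
      then show thesis by (rule that)
    qed
    \<comment> \<open>any positive \<open>\<eta>\<close> with \<open>\<bar>C\<bar> \<eta> < 1\<close> would do\<close>
    define \<eta> where "\<eta> = 1 / (\<bar>C\<bar> + 1)"
    have \<eta>: "0 < \<eta>" by (simp add: \<eta>_def add_nonneg_pos)
    obtain N where N: "\<And>n. n \<ge> N \<Longrightarrow> \<bar>p n\<bar> < \<eta>"
      using LIMSEQ_D[OF p_null \<eta>] by auto
    define e :: "nat \<Rightarrow> real \<Rightarrow> complex" where "e n = indicator {p n}" for n
    define c where "c n = 1 / (of_real (w n) * cnj (b (p n)))" for n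
    define f where "f = (\<lambda>x. c N * e N x - c (Suc N) * e (Suc N) x)"
    have w_nz: "w n \<noteq> 0" for n using w_pos by (metis less_irrefl)
    have e: "(\<lambda>x. k * e n x) \<in> L2 M" for k n
      unfolding e_def by (intro L2_scale indicator_atom_L2[OF w_pos inj_p L2_borel[OF b]])
    have f: "f \<in> L2 M" unfolding f_def by (rule L2_diff[OF e e])
    have "c n * L2_inner M (e n) b = 1" for n
      using w_nz[of n] b_nz[of n]
      by (simp add: e_def c_def L2_inner_indicator_atom[OF w_pos inj_p L2_borel[OF b]])
    then have orth: "L2_inner M f b = 0"
      unfolding f_def L2_inner_diff[OF e e b] L2_inner_scale by simp
    have "p N \<noteq> p (Suc N)" using inj_p by (simp add: inj_eq)
    then have "f (p N) = c N" by (simp add: f_def e_def)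
    then have f_nz: "f (p N) \<noteq> 0" using w_nz b_nz by (simp add: c_def)
    have pos: "0 < L2_norm M f"
    proof -
      have "L2_norm M f \<noteq> 0"
        using L2_norm_eq_0_imp[OF f] f_nz unfolding AE_M_iff by blast
      then show ?thesis using L2_norm_nonneg[of M f] by linarith
    qed
    have le: "cmod (of_real x * f x) \<le> \<eta> * cmod (f x)" for x
    proof (cases "x = p N \<or> x = p (Suc N)")
      case True
      then have "\<bar>x\<bar> \<le> \<eta>" using N[of N] N[of "Suc N"] by auto
      then show ?thesis by (simp add: norm_mult mult_right_mono)
    next
      case False
      then show ?thesis by (simp add: f_def e_def)
    qed
    have "L2_norm M (\<lambda>x. of_real x * f x) \<le> \<eta> * L2_norm M f"
      using le \<eta> by (intro L2_norm_dominated[OF f L2_measurable[OF mult_L2[OF f]]]) auto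
    then have "\<bar>C\<bar> * L2_norm M (\<lambda>x. of_real x * f x) \<le> \<bar>C\<bar> * (\<eta> * L2_norm M f)"
      by (rule mult_left_mono) simp
    moreover have "L2_norm M f \<le> \<bar>C\<bar> * L2_norm M (\<lambda>x. of_real x * f x)"
      using C[OF f] mult_right_mono[OF abs_ge_self[of C] L2_norm_nonneg[of M "\<lambda>x. of_real x * f x"]]
      by (simp add: orth)
    moreover have "\<bar>C\<bar> * \<eta> < 1" by (simp add: \<eta>_def)
    then have "\<bar>C\<bar> * \<eta> * L2_norm M f < L2_norm M f" using pos by simp
    ultimately show False by (simp add: mult.assoc)
  qed
  then show ?thesis by (auto simp: spectrum_def)
qed

lemma spectrum_rank_one_eq_zero:
  assumes a: "a \<in> L2 M" and b: "b \<in> L2 M"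
    and nz: "\<And>n. p n \<noteq> 0" "\<And>n. a (p n) \<noteq> 0" "\<And>n. b (p n) \<noteq> 0"
    and \<phi>: "\<And>\<zeta>. \<zeta> \<noteq> 0 \<Longrightarrow> (\<And>n. of_real (p n) \<noteq> \<zeta>) \<Longrightarrow>
      1 + L2_inner M (\<lambda>x. a x / (of_real x - \<zeta>)) b \<noteq> 0"
  shows "spectrum M (rank_one_perturbation M a b) = {0}"
proof -
  have "\<zeta> \<in> resolvent_set M (rank_one_perturbation M a b)" if \<zeta>: "\<zeta> \<noteq> 0" for \<zeta>
  proof (cases "\<exists>m. of_real (p m) = \<zeta>")
    case True
    then obtain m where "\<zeta> = of_real (p m)" by blast
    then show ?thesis using rank_one_resolvent_at_atom[OF a b nz] by simp
  next
    case False
    then have off: "\<And>n. of_real (p n) \<noteq> \<zeta>" by blast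
    show ?thesis by (rule rank_one_resolvent_off_atoms[OF a b \<zeta> off \<phi>[OF \<zeta> off]])
  qed
  then show ?thesis
    using zero_in_spectrum[OF b nz(3), of a] by (auto simp: spectrum_def)
qed

lemma L2_inner_sums:
  assumes "f \<in> L2 M" "b \<in> L2 M"
  shows "(\<lambda>n. w n *\<^sub>R (f (p n) * cnj (b (p n)))) sums L2_inner M f b"
proof -
  note [measurable] = L2_borel[OF assms(1)] L2_borel[OF assms(2)]
  have meas: "(\<lambda>x. f x * cnj (b x)) \<in> borel_measurable borel" by measurable
  note int = L2_inner_integrable[OF assms]
  have "summable (\<lambda>n. norm (w n *\<^sub>R (f (p n) * cnj (b (p n)))))"
    using int unfolding integrable_atomic_measure_iff[OF w_pos meas]
    using w_pos by (simp add: less_imp_le)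
  then show ?thesis
    unfolding L2_inner_def integral_atomic_measure[OF w_pos meas int]
    by (rule summable_sums[OF summable_norm_cancel])
qed

lemma ex_function_with_values_at_atoms:
  obtains f where "f \<in> borel_measurable borel" "\<And>n. f (p n) = (v n :: complex)"
proof (rule that)
  let ?f = "\<lambda>x. if x \<in> range p then v (inv p x) else 0"
  show "?f (p n) = v n" for n by (simp add: inv_f_f[OF inj_p])
  show "?f \<in> borel_measurable borel"
    by (rule measurable_discrete_difference[of "\<lambda>x. 0" _ _ "range p"]) auto
qed

text \<open>
  Since \<open>\<omega>\<close> is nonzero at the atoms, the only candidate for the square integrable factor is the
  quotient by \<open>\<omega>\<close>.
\<close>

lemma weighted_L2_iff:
  assumes \<omega>: "\<omega> \<in> borel_measurable borel" and nz: "\<And>n. \<omega> (p n) \<noteq> 0"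
  shows "f \<in> weighted_L2 \<omega> M \<longleftrightarrow>
    f \<in> borel_measurable borel \<and> summable (\<lambda>n. w n * (cmod (f (p n)) / \<omega> (p n))\<^sup>2)"
proof
  assume "f \<in> weighted_L2 \<omega> M"
  then obtain g where f: "f \<in> borel_measurable M" and g: "g \<in> L2 M"
    and fg: "\<And>n. f (p n) = of_real (\<omega> (p n)) * g (p n)"
    unfolding weighted_L2_def AE_M_iff by blast
  have "(cmod (f (p n)) / \<omega> (p n))\<^sup>2 = (cmod (g (p n)))\<^sup>2" for n
    using nz[of n] by (simp add: fg norm_mult power_divide power_mult_distrib)
  then show "f \<in> borel_measurable borel \<and> summable (\<lambda>n. w n * (cmod (f (p n)) / \<omega> (p n))\<^sup>2)"
    using f g by (simp add: L2_atomic_measure_iff[OF w_pos])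
next
  assume f: "f \<in> borel_measurable borel \<and> summable (\<lambda>n. w n * (cmod (f (p n)) / \<omega> (p n))\<^sup>2)"
  define g where "g = (\<lambda>x. f x / complex_of_real (\<omega> x))"
  have "f \<in> borel_measurable borel" using f by simp
  note [measurable] = this \<omega>
  have "g \<in> borel_measurable borel" unfolding g_def by measurable
  moreover have "(cmod (f (p n)) / \<omega> (p n))\<^sup>2 = (cmod (g (p n)))\<^sup>2" for n
    by (simp add: g_def norm_divide power_divide)
  ultimately have "g \<in> L2 M"
    using f by (simp add: L2_atomic_measure_iff[OF w_pos])
  moreover have "AE x in M. f x = of_real (\<omega> x) * g x"
    using nz by (simp add: AE_M_iff g_def)
  ultimately show "f \<in> weighted_L2 \<omega> M"
    using f unfolding weighted_L2_def by auto
qed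

lemma weighted_L2_powr_subset:
  assumes "0 \<le> \<alpha>" "f \<in> weighted_L2 (\<lambda>x. \<bar>x\<bar> powr \<alpha>) M"
  shows "f \<in> L2 M"
proof -
  obtain B where B: "\<And>n. \<bar>p n\<bar> \<le> B"
    by (rule p_bounded) blast
  obtain g where f: "f \<in> borel_measurable M" and g: "g \<in> L2 M"
    and fg: "\<And>n. f (p n) = of_real (\<bar>p n\<bar> powr \<alpha>) * g (p n)"
    using assms(2) unfolding weighted_L2_def AE_M_iff by blast
  show ?thesis
  proof (rule L2_dominated[OF g f])
    show "AE x in M. cmod (f x) \<le> B powr \<alpha> * cmod (g x)"
      unfolding AE_M_iff fg using assms(1) B
      by (simp add: norm_mult mult_right_mono powr_mono2)
  qed simp
qed

end

section \<open>Zeros of conditionally convergent products\<close>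

lemma sum_le_prod_one_plus:
  fixes x :: "'a \<Rightarrow> real"
  assumes "finite F" "\<And>n. n \<in> F \<Longrightarrow> 0 \<le> x n"
  shows "sum x F \<le> (\<Prod>n\<in>F. 1 + x n)"
  using assms
proof (induction F rule: finite_induct)
  case (insert n F)
  have "1 \<le> (\<Prod>n\<in>F. 1 + x n)"
    using insert.prems by (intro prod_ge_1) simp
  then have "x n \<le> x n * (\<Prod>n\<in>F. 1 + x n)"
    using insert.prems mult_left_mono[of 1 "\<Prod>n\<in>F. 1 + x n" "x n"] by simp
  then show ?case using insert by (simp add: ring_distribs)
qed simp

text \<open>
  The bound is uniform over all finite index sets, so it applies to partial products in any order.
  Replacing the factors by \<open>v n = min 1 \<bar>1 + u n\<bar>\<close> makes products decrease when indices are
  added: the indices below \<open>N\<close> contribute at least the product of all \<open>v n\<close> with \<open>n < N\<close>, and those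
  beyond \<open>N\<close> at least \<open>1 - \<Sum> \<bar>u n\<bar> \<ge> 1 / 2\<close>.
\<close>

lemma finite_products_bounded_away_from_zero:
  fixes u :: "nat \<Rightarrow> 'a::{real_normed_field}"
  assumes sum: "summable (\<lambda>n. norm (u n))" and nz: "\<And>n. 1 + u n \<noteq> 0"
  obtains c where "0 < c" "\<And>F. finite F \<Longrightarrow> c \<le> norm (\<Prod>n\<in>F. 1 + u n)"
proof -
  define v where "v n = min 1 (norm (1 + u n))" for n
  have v: "0 < v n" "v n \<le> 1" "v n \<le> norm (1 + u n)" for n
    using nz[of n] by (simp_all add: v_def)
  have v_u: "1 - v n \<le> norm (u n)" for n
    using norm_diff_ineq[of 1 "u n"] by (simp add: v_def min_def)
  obtain N where N: "norm (\<Sum>i. norm (u (i + N))) < 1 / 2"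
    using suminf_exist_split[OF _ sum, of "1 / 2"] by auto
  have tail: "sum (\<lambda>n. norm (u n)) G \<le> 1 / 2" if "finite G" "G \<subseteq> {N..}" for G
  proof -
    have "sum (\<lambda>n. norm (u n)) G = sum (\<lambda>i. norm (u (i + N))) ((\<lambda>n. n - N) ` G)"
    proof -
      have le: "N \<le> n" if "n \<in> G" for n using that \<open>G \<subseteq> {N..}\<close> by auto
      have "inj_on (\<lambda>n. n - N) G"
        by (intro inj_onI) (metis le le_add_diff_inverse)
      then show ?thesis by (simp add: sum.reindex le)
    qed
    also have "\<dots> \<le> (\<Sum>i. norm (u (i + N)))"
      using that(1) sum by (intro sum_le_suminf) (auto simp: summable_iff_shift[of "\<lambda>n. norm (u n)"])
    finally show ?thesis using N by simp
  qed
  define c where "c = (\<Prod>n<N. v n) / 2"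
  show thesis
  proof (rule that[of c])
    show "0 < c" using v(1) by (simp add: c_def prod_pos)
    fix F :: "nat set" assume F: "finite F"
    let ?H = "F \<inter> {..<N}" and ?G = "F - {..<N}"
    have "(\<Prod>n<N. v n) = (\<Prod>n\<in>?H. v n) * (\<Prod>n\<in>{..<N} - ?H. v n)"
      by (subst mult.commute) (rule prod.subset_diff; auto)
    also have "\<dots> \<le> (\<Prod>n\<in>?H. v n) * 1"
      using v by (intro mult_left_mono prod_le_1 prod_nonneg) (auto intro: less_imp_le)
    finally have H: "(\<Prod>n<N. v n) \<le> (\<Prod>n\<in>?H. v n)" by simp
    have "?G \<subseteq> {N..}" by auto
    then have "1 / 2 \<le> 1 - (\<Sum>n\<in>?G. norm (u n))"
      using tail[of ?G] F by simp
    also have "\<dots> \<le> 1 - (\<Sum>n\<in>?G. 1 - v n)"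
      using v_u by (simp add: sum_mono)
    also have "\<dots> \<le> (\<Prod>n\<in>?G. 1 - (1 - v n))"
      by (rule Weierstrass_prod_ineq) (use v in \<open>auto intro: less_imp_le\<close>)
    finally have G: "1 / 2 \<le> (\<Prod>n\<in>?G. v n)" by simp
    have "c = (\<Prod>n<N. v n) * (1 / 2)" by (simp add: c_def)
    also have "\<dots> \<le> (\<Prod>n\<in>?H. v n) * (\<Prod>n\<in>?G. v n)"
      using H G v by (intro mult_mono prod_nonneg) (auto intro: less_imp_le)
    also have "\<dots> = (\<Prod>n\<in>F. v n)"
      using F by (metis prod.Int_Diff)
    also have "\<dots> \<le> (\<Prod>n\<in>F. norm (1 + u n))"
      using v by (intro prod_mono) (auto intro: less_imp_le)
    finally show "c \<le> norm (\<Prod>n\<in>F. 1 + u n)" by (simp add: prod_norm)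
  qed
qed

text \<open>
  At \<open>z = \<i>\<close> the squared moduli of the factors are \<open>1 + 1 / (t n)\<^sup>2\<close>, and such a product dominates
  the sum of the \<open>1 / (t n)\<^sup>2\<close>.
\<close>

lemma summable_inverse_squares_if_product_converges:
  fixes t :: "nat \<Rightarrow> real"
  assumes fin: "\<And>R. finite {n. \<bar>t n\<bar> \<le> R}"
    and lim: "((\<lambda>R. \<Prod>n | \<bar>t n\<bar> \<le> R. (1 - \<i> / of_real (t n))) \<longlongrightarrow> L) at_top"
  shows "summable (\<lambda>n. (1 / t n)\<^sup>2)"
proof -
  let ?P = "\<lambda>R. \<Prod>n | \<bar>t n\<bar> \<le> R. (1 - \<i> / of_real (t n))"
  have factor: "(cmod (1 - \<i> / of_real (t n)))\<^sup>2 = 1 + (1 / t n)\<^sup>2" for n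
    by (simp add: cmod_power2 power_divide)
  have P: "(cmod (?P R))\<^sup>2 = (\<Prod>n | \<bar>t n\<bar> \<le> R. 1 + (1 / t n)\<^sup>2)" for R
    by (simp only: prod_norm[symmetric] prod_power_distrib factor)
  have "((\<lambda>R. (cmod (?P R))\<^sup>2) \<longlongrightarrow> (cmod L)\<^sup>2) at_top"
    by (intro tendsto_intros lim)
  then have ev: "eventually (\<lambda>R. (cmod (?P R))\<^sup>2 < (cmod L)\<^sup>2 + 1) at_top"
    by (rule order_tendstoD) simp
  have "(\<Sum>n\<le>N. (1 / t n)\<^sup>2) \<le> (cmod L)\<^sup>2 + 1" for N
  proof -
    have "eventually (\<lambda>R. (\<Sum>n\<le>N. \<bar>t n\<bar>) \<le> R) at_top" by (rule eventually_ge_at_top)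
    with ev have "eventually (\<lambda>R. (cmod (?P R))\<^sup>2 < (cmod L)\<^sup>2 + 1 \<and> (\<Sum>n\<le>N. \<bar>t n\<bar>) \<le> R) at_top"
      by (rule eventually_conj)
    then obtain R where R: "(cmod (?P R))\<^sup>2 < (cmod L)\<^sup>2 + 1" "(\<Sum>n\<le>N. \<bar>t n\<bar>) \<le> R"
      using eventually_happens'[OF trivial_limit_at_top_linorder] by blast
    have "\<bar>t n\<bar> \<le> R" if "n \<le> N" for n
      using R(2) member_le_sum[of n "{..N}" "\<lambda>n. \<bar>t n\<bar>"] that by auto
    then have "(\<Sum>n\<le>N. (1 / t n)\<^sup>2) \<le> (\<Sum>n | \<bar>t n\<bar> \<le> R. (1 / t n)\<^sup>2)"
      by (intro sum_mono2 fin) auto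
    also have "\<dots> \<le> (cmod (?P R))\<^sup>2"
      unfolding P by (rule sum_le_prod_one_plus[OF fin]) simp
    finally show ?thesis using R(1) by linarith
  qed
  then show ?thesis by (intro bounded_imp_summable) auto
qed

text \<open>
  The convergence may be merely conditional, so a priori the limit could vanish without any factor
  vanishing.  To exclude this for real \<open>\<tau>\<close>, multiply the products at the three points \<open>\<tau>\<close>, \<open>w\<close>,
  \<open>cnj w\<close> with \<open>w = - \<tau> / 2 + \<i>\<close>.  The points add up to zero, so the terms of first order in
  \<open>1 / t n\<close> cancel and the combined product converges absolutely.  Its factors at the nonreal points
  never vanish.  Hence \<open>A \<tau> A w A (cnj w) \<noteq> 0\<close> unless \<open>\<tau>\<close> is one of the \<open>t n\<close>.
\<close>

lemma principal_value_product_real_zeros: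
  fixes t :: "nat \<Rightarrow> real" and A :: "complex \<Rightarrow> complex"
  assumes t_nz: "\<And>n. t n \<noteq> 0" and fin: "\<And>R. finite {n. \<bar>t n\<bar> \<le> R}"
    and lim: "\<And>z. ((\<lambda>R. \<Prod>n | \<bar>t n\<bar> \<le> R. (1 - z / of_real (t n))) \<longlongrightarrow> A z) at_top"
  shows "A (of_real \<tau>) = 0 \<longleftrightarrow> \<tau> \<in> range t"
proof
  assume "\<tau> \<in> range t"
  then obtain m where m: "\<tau> = t m" by blast
  have "eventually (\<lambda>R. (\<Prod>n | \<bar>t n\<bar> \<le> R. (1 - of_real \<tau> / complex_of_real (t n))) = 0) at_top"
    using eventually_ge_at_top[of "\<bar>t m\<bar>"]
  proof eventually_elim
    case (elim R)
    then show ?case using fin[of R] t_nz[of m] m by (auto simp: prod_zero_iff)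
  qed
  from tendsto_cong[THEN iffD1, OF this lim[of "of_real \<tau>"]] show "A (of_real \<tau>) = 0"
    by (simp add: tendsto_const_iff)
next
  assume zero: "A (of_real \<tau>) = 0"
  show "\<tau> \<in> range t"
  proof (rule ccontr)
    assume \<tau>: "\<tau> \<notin> range t"
    define w where "w = Complex (- \<tau> / 2) 1"
    define X where "X n = complex_of_real (1 / t n)" for n
    define q where "q z n = 1 - z / complex_of_real (t n)" for z n
    define u where "u n = q (of_real \<tau>) n * q w n * q (cnj w) n - 1" for n
    have q_nz: "q (of_real \<tau>) n \<noteq> 0" "q w n \<noteq> 0" "q (cnj w) n \<noteq> 0" for n
    proof -
      have q0: "q z n = 0 \<longleftrightarrow> z = of_real (t n)" for z
        using t_nz[of n] by (auto simp: q_def field_simps)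
      show "q (of_real \<tau>) n \<noteq> 0" using \<tau> by (auto simp: q0)
      show "q w n \<noteq> 0" "q (cnj w) n \<noteq> 0"
        unfolding q0 w_def by (simp_all add: complex_eq_iff)
    qed
    define e2 where "e2 = of_real \<tau> * (w + cnj w) + w * cnj w"
    define e3 where "e3 = of_real \<tau> * w * cnj w"
    have e1: "of_real \<tau> + w + cnj w = 0"
      by (simp add: w_def complex_eq_iff)
    have u: "u n = e2 * (X n)\<^sup>2 - e3 * (X n) ^ 3" for n
    proof -
      have "u n = - (of_real \<tau> + w + cnj w) * X n + e2 * (X n)\<^sup>2 - e3 * (X n) ^ 3"
        by (simp add: u_def q_def X_def e2_def e3_def divide_inverse power2_eq_square
            power3_eq_cube algebra_simps)
      then show ?thesis unfolding e1 by simp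
    qed
    have inv_sq: "summable (\<lambda>n. (1 / t n)\<^sup>2)"
      by (rule summable_inverse_squares_if_product_converges[OF fin lim])
    obtain B where B: "\<And>n. \<bar>1 / t n\<bar> \<le> B"
    proof -
      have "\<bar>1 / t n\<bar> \<le> sqrt (\<Sum>n. (1 / t n)\<^sup>2)" for n
        using sum_le_suminf[OF inv_sq, of "{n}"] by (intro real_le_rsqrt) (simp add: power_divide)
      then show thesis by (rule that)
    qed
    have u_le: "cmod (u n) \<le> (cmod e2 + cmod e3 * B) * (1 / t n)\<^sup>2" for n
    proof -
      have nX: "cmod (X n) = \<bar>1 / t n\<bar>" unfolding X_def by (rule norm_of_real)
      have "cmod (u n) \<le> cmod (e2 * (X n)\<^sup>2) + cmod (e3 * (X n) ^ 3)"
        unfolding u by (rule norm_triangle_ineq4)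
      also have "\<dots> = cmod e2 * (1 / t n)\<^sup>2 + (cmod e3 * \<bar>1 / t n\<bar>) * (1 / t n)\<^sup>2"
        by (simp only: norm_mult norm_power nX power3_eq_cube power2_eq_square
            abs_mult_self_eq mult.assoc)
      also have "\<dots> \<le> cmod e2 * (1 / t n)\<^sup>2 + (cmod e3 * B) * (1 / t n)\<^sup>2"
        using B by (intro add_left_mono mult_right_mono mult_left_mono) auto
      finally show ?thesis by (simp add: ring_distribs)
    qed
    have "summable (\<lambda>n. cmod (u n))"
      by (rule summable_comparison_test'[OF summable_mult[OF inv_sq, of "cmod e2 + cmod e3 * B"], of 0])
        (simp only: u_le real_norm_def abs_norm_cancel)
    moreover have "1 + u n \<noteq> 0" for n
      using q_nz[of n] by (simp add: u_def)
    ultimately obtain c where c: "0 < c" "\<And>F. finite F \<Longrightarrow> c \<le> cmod (\<Prod>n\<in>F. 1 + u n)"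
      using finite_products_bounded_away_from_zero by blast
    have "((\<lambda>R. cmod (\<Prod>n | \<bar>t n\<bar> \<le> R. 1 + u n)) \<longlongrightarrow> cmod (A (of_real \<tau>) * A w * A (cnj w))) at_top"
    proof -
      have "(\<Prod>n | \<bar>t n\<bar> \<le> R. 1 + u n) = (\<Prod>n | \<bar>t n\<bar> \<le> R. q (of_real \<tau>) n) *
          (\<Prod>n | \<bar>t n\<bar> \<le> R. q w n) * (\<Prod>n | \<bar>t n\<bar> \<le> R. q (cnj w) n)" for R
        by (simp add: u_def prod.distrib)
      then show ?thesis
        unfolding q_def by (simp only:) (intro tendsto_intros lim)
    qed
    then have "c \<le> cmod (A (of_real \<tau>) * A w * A (cnj w))"
      by (rule tendsto_lowerbound) (simp_all add: c(2) fin)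
    then show False using c(1) zero by simp
  qed
qed

section \<open>Distributing a summable sequence between two factors\<close>

text \<open>
  Geometric weights \<open>(1 / 2) ^ k\<close> on a subsequence of \<open>S\<close> along which \<open>\<tau>\<close> is at least \<open>2 ^ k\<close>.
\<close>

lemma sparse_weight:
  fixes \<tau> :: "nat \<Rightarrow> real"
  assumes \<tau>: "filterlim \<tau> at_top sequentially" and S: "infinite S"
  obtains u where "\<And>n. 0 \<le> u n" "\<And>n. n \<notin> S \<Longrightarrow> u n = 0" "summable u"
    "\<not> summable (\<lambda>n. u n * \<tau> n)"
proof -
  have ex: "\<exists>n>m. n \<in> S \<and> 2 ^ k \<le> \<tau> n" for m k
  proof -
    obtain N where N: "\<And>n. n \<ge> N \<Longrightarrow> 2 ^ k \<le> \<tau> n"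
      using \<tau> unfolding filterlim_at_top eventually_sequentially by blast
    obtain n where "n > max m N" "n \<in> S"
      using S unfolding infinite_nat_iff_unbounded by blast
    then show ?thesis using N[of n] by auto
  qed
  have "\<exists>r. \<forall>k. (r k \<in> S \<and> 2 ^ k \<le> \<tau> (r k)) \<and> r k < r (Suc k)"
  proof (rule dependent_nat_choice)
    show "\<exists>n. n \<in> S \<and> 2 ^ 0 \<le> \<tau> n" using ex[of 0 0] by blast
    show "\<exists>n. (n \<in> S \<and> 2 ^ Suc k \<le> \<tau> n) \<and> m < n" for m k using ex[of m "Suc k"] by blast
  qed
  then obtain r where r: "\<And>k. r k \<in> S" "\<And>k. 2 ^ k \<le> \<tau> (r k)" "\<And>k. r k < r (Suc k)"
    by blast
  have mono: "strict_mono r" using r(3) by (simp add: strict_mono_Suc_iff)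
  have inj: "inj r" using mono by (rule strict_mono_imp_inj_on)
  define u where "u n = (if n \<in> range r then (1 / 2) ^ (inv r n) else 0 :: real)" for n
  have ur: "u (r k) = (1 / 2) ^ k" for k by (simp add: u_def inv_f_f[OF inj])
  have u0: "u n = 0" if "n \<notin> range r" for n using that by (simp add: u_def)
  show thesis
  proof (rule that)
    show "0 \<le> u n" for n by (simp add: u_def)
    show "u n = 0" if "n \<notin> S" for n using that r(1) by (auto simp: u_def)
    have "summable (\<lambda>k. u (r k))" by (simp add: ur summable_geometric)
    then show "summable u" using summable_mono_reindex[OF mono, of u] u0 by simp
    show "\<not> summable (\<lambda>n. u n * \<tau> n)"
    proof
      assume "summable (\<lambda>n. u n * \<tau> n)"
      then have "summable (\<lambda>k. u (r k) * \<tau> (r k))"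
        using summable_mono_reindex[OF mono, of "\<lambda>n. u n * \<tau> n"] u0 by simp
      then have "(\<lambda>k. u (r k) * \<tau> (r k)) \<longlonglongrightarrow> 0" by (rule summable_LIMSEQ_zero)
      moreover have "1 \<le> u (r k) * \<tau> (r k)" for k
        using r(2)[of k] by (simp add: ur power_one_over field_simps)
      ultimately have "1 \<le> (0::real)"
        by (intro tendsto_lowerbound[of _ 0 sequentially 1]) auto
      then show False by simp
    qed
  qed
qed

text \<open>
  Starting from \<open>X = Y = E\<close>, add a sparse weight \<open>u\<close> to \<open>X\<close> and another one, \<open>v\<close>, to \<open>Y\<close>, and
  correct the other factor so that the product stays \<open>E\<^sup>2\<close>:
  \<open>X = E (E + u) / (E + v)\<close> and \<open>Y = E (E + v) / (E + u)\<close>.  The corrections only decrease the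
  factors, and disjointness of the supports keeps \<open>X \<ge> u\<close> and \<open>Y \<ge> v\<close>.
\<close>

lemma factorization_with_divergent_moments:
  fixes E \<sigma>1 \<sigma>2 :: "nat \<Rightarrow> real"
  assumes E: "\<And>n. 0 < E n" "summable E"
    and \<sigma>1: "filterlim \<sigma>1 at_top sequentially" and \<sigma>2: "filterlim \<sigma>2 at_top sequentially"
  obtains X Y where "\<And>n. 0 < X n" "\<And>n. 0 < Y n" "\<And>n. X n * Y n = (E n)\<^sup>2"
    "summable X" "summable Y" "\<not> summable (\<lambda>n. X n * \<sigma>1 n)" "\<not> summable (\<lambda>n. Y n * \<sigma>2 n)"
proof -
  have "\<exists>n\<ge>m. even n" "\<exists>n\<ge>m. odd n" for m :: nat
    by (rule exI[of _ "2 * m"], simp, rule exI[of _ "2 * m + 1"], simp)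
  then have inf_even: "infinite {n::nat. even n}" and inf_odd: "infinite {n::nat. odd n}"
    by (simp_all add: infinite_nat_iff_unbounded_le)
  obtain u where u: "\<And>n. 0 \<le> u n" "\<And>n. n \<notin> {n. even n} \<Longrightarrow> u n = 0" "summable u"
      "\<not> summable (\<lambda>n. u n * \<sigma>1 n)"
    using sparse_weight[OF \<sigma>1 inf_even] by metis
  obtain v where v: "\<And>n. 0 \<le> v n" "\<And>n. n \<notin> {n. odd n} \<Longrightarrow> v n = 0" "summable v"
      "\<not> summable (\<lambda>n. v n * \<sigma>2 n)"
    using sparse_weight[OF \<sigma>2 inf_odd] by metis
  have half: "summable (\<lambda>n. E n * (E n + f n) / (E n + g n)) \<and>
      \<not> summable (\<lambda>n. E n * (E n + f n) / (E n + g n) * \<sigma> n)"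
    if f: "\<And>n. 0 \<le> f n" "summable f" "\<not> summable (\<lambda>n. f n * \<sigma> n)"
      and g: "\<And>n. 0 \<le> g n" and disj: "\<And>n. f n = 0 \<or> g n = 0"
      and \<sigma>: "filterlim \<sigma> at_top sequentially" for f g \<sigma> :: "nat \<Rightarrow> real"
  proof
    let ?X = "\<lambda>n. E n * (E n + f n) / (E n + g n)"
    have pos: "0 < E n + g n" "0 \<le> E n + f n" for n
      using E(1)[of n] f(1)[of n] g[of n] by auto
    have X_nonneg: "0 \<le> ?X n" for n
      using E(1)[of n] pos[of n] by (intro divide_nonneg_pos mult_nonneg_nonneg) auto
    have X_le: "?X n \<le> E n + f n" for n
    proof -
      have "E n * (E n + f n) \<le> (E n + g n) * (E n + f n)"
        using pos[of n] g[of n] by (intro mult_right_mono) auto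
      then show ?thesis using pos[of n] by (simp add: pos_divide_le_eq mult.commute)
    qed
    have X_ge: "f n \<le> ?X n" for n
      using disj[of n]
    proof
      assume "f n = 0" then show ?thesis using X_nonneg[of n] by simp
    next
      assume "g n = 0" then show ?thesis using E(1)[of n] by simp
    qed
    have "norm (?X n) \<le> E n + f n" for n
      using X_le[of n] X_nonneg[of n] by (simp only: real_norm_def abs_of_nonneg)
    then show "summable ?X"
      by (rule summable_comparison_test'[OF summable_add[OF E(2) f(2)], of 0])
    show "\<not> summable (\<lambda>n. ?X n * \<sigma> n)"
    proof
      assume sum: "summable (\<lambda>n. ?X n * \<sigma> n)"
      obtain N where N: "\<And>n. n \<ge> N \<Longrightarrow> 0 \<le> \<sigma> n"
        using \<sigma> unfolding filterlim_at_top eventually_sequentially by blast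
      have "norm (f n * \<sigma> n) \<le> ?X n * \<sigma> n" if "n \<ge> N" for n
        using mult_right_mono[OF X_ge N[OF that]] f(1)[of n] N[OF that] by (simp add: abs_mult)
      then have "summable (\<lambda>n. f n * \<sigma> n)"
        by (rule summable_comparison_test'[OF sum])
      then show False using f(3) by simp
    qed
  qed
  have disj: "u n = 0 \<or> v n = 0" "v n = 0 \<or> u n = 0" for n
    using u(2)[of n] v(2)[of n] by (cases "even n"; simp)+
  note half_uv = half[OF u(1,3,4) v(1) disj(1) \<sigma>1]
    and half_vu = half[OF v(1,3,4) u(1) disj(2) \<sigma>2]
  have pos: "0 < E n + u n" "0 < E n + v n" for n
    using E(1)[of n] u(1)[of n] v(1)[of n] by auto
  show thesis
  proof (rule that[of "\<lambda>n. E n * (E n + u n) / (E n + v n)" "\<lambda>n. E n * (E n + v n) / (E n + u n)"])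
    show "0 < E n * (E n + u n) / (E n + v n)" "0 < E n * (E n + v n) / (E n + u n)" for n
      using E(1)[of n] pos[of n] by auto
    show "E n * (E n + u n) / (E n + v n) * (E n * (E n + v n) / (E n + u n)) = (E n)\<^sup>2" for n
      using pos[of n] by (simp add: power2_eq_square)
    show "summable (\<lambda>n. E n * (E n + u n) / (E n + v n))"
      "\<not> summable (\<lambda>n. E n * (E n + u n) / (E n + v n) * \<sigma>1 n)"
      by (rule half_uv[THEN conjunct1], rule half_uv[THEN conjunct2])
    show "summable (\<lambda>n. E n * (E n + v n) / (E n + u n))"
      "\<not> summable (\<lambda>n. E n * (E n + v n) / (E n + u n) * \<sigma>2 n)"
      by (rule half_vu[THEN conjunct1], rule half_vu[THEN conjunct2])
  qed
qed

section \<open>Removing the nonzero spectrum\<close>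

theorem theorem8p1:
  fixes s t \<nu> :: "nat \<Rightarrow> real" and A :: "complex \<Rightarrow> complex" and \<gamma> \<alpha>1 \<alpha>2 :: real
  assumes "inj s" and "\<forall>n. s n \<noteq> 0" and "s \<longlonglongrightarrow> 0"
    and "\<forall>n. t n = 1 / s n"
    and "removable_spectrum t"
    and "\<forall>z. ((\<lambda>R::real. \<Prod>n | \<bar>t n\<bar> \<le> R. (1 - z / complex_of_real (t n))) \<longlongrightarrow> A z) at_top"
    and "A \<in> Krein_class"
    and "0 < \<gamma>" and "\<gamma> < 2"
    and "summable (\<lambda>n. 1 / (\<bar>t n\<bar> powr \<gamma> * cmod (deriv A (complex_of_real (t n)))))"
    and "\<forall>n. 0 < \<nu> n"
    and "0 \<le> \<alpha>1" and "\<alpha>1 < 1" and "0 \<le> \<alpha>2" and "\<alpha>2 < 1" and "\<alpha>1 + \<alpha>2 \<le> 2 - \<gamma>"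
  shows "\<exists>a b.
    a \<in> weighted_L2 (\<lambda>x. \<bar>x\<bar> powr \<alpha>1) (atomic_measure \<nu> s) \<and>
    b \<in> weighted_L2 (\<lambda>x. \<bar>x\<bar> powr \<alpha>2) (atomic_measure \<nu> s) \<and>
    a \<notin> weighted_L2 (\<lambda>x. x) (atomic_measure \<nu> s) \<and>
    b \<notin> weighted_L2 (\<lambda>x. x) (atomic_measure \<nu> s) \<and>
    spectrum (atomic_measure \<nu> s) (rank_one_perturbation (atomic_measure \<nu> s) a b) = {0}"
proof -
  note s_inj = assms(1) and s_null = assms(3) and lim = assms(6)[rule_format]
  have s_nz: "s n \<noteq> 0" and t_s: "t n = 1 / s n" and \<nu>: "0 < \<nu> n" for n
    using assms(2,4,11) by simp_all
  have t_nz: "t n \<noteq> 0" and s_t: "s n = 1 / t n" for n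
    using s_nz[of n] by (simp_all add: t_s)
  interpret compact_multiplication \<nu> s
    using assms(1,3,11) by unfold_locales
  define \<tau> where "\<tau> n = \<bar>t n\<bar>" for n
  have \<tau>: "0 < \<tau> n" and abs_s: "\<bar>s n\<bar> = 1 / \<tau> n" for n
    using t_nz[of n] by (simp_all add: \<tau>_def s_t)
  have \<tau>_lim: "filterlim \<tau> at_top sequentially"
  proof -
    have "filterlim (\<lambda>n. inverse (s n)) at_infinity sequentially"
      using s_null s_nz by (intro filterlim_compose[OF filterlim_inverse_at_infinity])
        (auto simp: filterlim_at)
    then show ?thesis
      unfolding filterlim_at_infinity_conv_norm_at_top
      by (simp add: \<tau>_def[abs_def] t_s divide_inverse)
  qed
  have fin: "finite {n. \<bar>t n\<bar> \<le> R}" for R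
  proof -
    obtain N where N: "\<And>n. n \<ge> N \<Longrightarrow> R + 1 \<le> \<tau> n"
      using \<tau>_lim unfolding filterlim_at_top eventually_sequentially by blast
    have "n < N" if "\<bar>t n\<bar> \<le> R" for n
    proof (rule ccontr)
      assume "\<not> n < N"
      then show False using N[of n] that by (simp add: \<tau>_def)
    qed
    then have "{n. \<bar>t n\<bar> \<le> R} \<subseteq> {..<N}" by auto
    then show ?thesis by (rule finite_subset) simp
  qed
  have Krein_zero: "z \<in> \<real> \<and> deriv A z \<noteq> 0" if "A z = 0" for z
    using assms(7) that by (simp add: Krein_class_def)
  have zeros: "{z. A z = 0} = range (\<lambda>n. complex_of_real (t n))"
  proof (intro set_eqI)
    fix z
    show "z \<in> {z. A z = 0} \<longleftrightarrow> z \<in> range (\<lambda>n. complex_of_real (t n))"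
    proof (cases "z \<in> \<real>")
      case True
      then obtain x where x: "z = of_real x" by (auto elim: Reals_cases)
      show ?thesis
        unfolding x using principal_value_product_real_zeros[OF t_nz fin lim, of x] by auto
    next
      case False
      then show ?thesis using Krein_zero[of z] by auto
    qed
  qed
  have A0: "A 0 = 1"
    using lim[of 0] by (simp add: tendsto_const_iff)
  have t_inj: "inj (\<lambda>n. complex_of_real (t n))"
    using s_inj by (auto simp: inj_def t_s)
  define d where "d n = 1 / deriv A (complex_of_real (t n))" for n
  have d_nz: "d n \<noteq> 0" for n
  proof -
    have "A (of_real (t n)) = 0" using zeros by blast
    then show ?thesis using Krein_zero by (simp add: d_def)
  qed
  have expansion: "(\<lambda>n. - d n * (1 / (of_real (t n) - z) - 1 / of_real (t n))) sums (1 / A z - 1)"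
    if "A z \<noteq> 0" for z
  proof -
    have "((\<lambda>t. (- 1 / deriv A t) * (1 / (t - z) - 1 / t)) has_sum (1 / A z - 1 / A 0)) {t. A t = 0}"
      using assms(7) that by (simp add: Krein_class_def)
    then have "((\<lambda>n. - d n * (1 / (of_real (t n) - z) - 1 / of_real (t n))) has_sum (1 / A z - 1)) UNIV"
      unfolding zeros has_sum_reindex[OF t_inj] by (simp add: o_def d_def A0)
    then show ?thesis by (rule has_sum_imp_sums)
  qed

  \<comment> \<open>\<open>d n / (t n)\<^sup>2\<close> is the value that \<open>\<nu> a (cnj b)\<close> must take at \<open>s n\<close>.  The sequence \<open>E\<close> absorbs
  the two weights: \<open>E\<^sup>2\<close> has to split into the terms \<open>X\<close>, \<open>Y\<close> of the two weighted norms of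
  \<open>a\<close> and \<open>b\<close>.\<close>
  define E where "E n = cmod (d n) * \<tau> n powr (\<alpha>1 + \<alpha>2 - 2)" for n
  have E_pos: "0 < E n" for n using d_nz[of n] \<tau>[of n] by (simp add: E_def)
  have E_sum: "summable E"
  proof -
    obtain N where N: "\<And>n. n \<ge> N \<Longrightarrow> 1 \<le> \<tau> n"
      using \<tau>_lim unfolding filterlim_at_top eventually_sequentially by blast
    have "norm (E n) \<le> 1 / (\<bar>t n\<bar> powr \<gamma> * cmod (deriv A (complex_of_real (t n))))" if "n \<ge> N" for n
    proof -
      have "\<tau> n powr (\<alpha>1 + \<alpha>2 - 2) \<le> \<tau> n powr (- \<gamma>)"
        using N[OF that] assms(16) by (intro powr_mono) auto
      then have "E n \<le> cmod (d n) * \<tau> n powr (- \<gamma>)"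
        unfolding E_def by (rule mult_left_mono) simp
      also have "\<dots> = 1 / (\<bar>t n\<bar> powr \<gamma> * cmod (deriv A (complex_of_real (t n))))"
        by (simp add: d_def norm_divide powr_minus_divide \<tau>_def)
      finally show ?thesis using E_pos[of n] by simp
    qed
    then show ?thesis by (rule summable_comparison_test'[OF assms(10)])
  qed
  have \<sigma>_lim: "filterlim (\<lambda>n. \<tau> n powr (2 - 2 * \<alpha>)) at_top sequentially" if "\<alpha> < 1" for \<alpha>
    unfolding filterlim_at_top
  proof
    fix Z :: real
    have "eventually (\<lambda>n. (\<bar>Z\<bar> + 1) powr (1 / (2 - 2 * \<alpha>)) \<le> \<tau> n) sequentially"
      using \<tau>_lim unfolding filterlim_at_top by blast
    then show "eventually (\<lambda>n. Z \<le> \<tau> n powr (2 - 2 * \<alpha>)) sequentially"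
    proof eventually_elim
      case (elim n)
      then have "((\<bar>Z\<bar> + 1) powr (1 / (2 - 2 * \<alpha>))) powr (2 - 2 * \<alpha>) \<le> \<tau> n powr (2 - 2 * \<alpha>)"
        using that by (intro powr_mono2) auto
      then have "\<bar>Z\<bar> + 1 \<le> \<tau> n powr (2 - 2 * \<alpha>)"
        using that by (simp add: powr_powr)
      then show ?case by linarith
    qed
  qed
  obtain X Y where XY: "\<And>n. 0 < X n" "\<And>n. 0 < Y n" "\<And>n. X n * Y n = (E n)\<^sup>2"
    "summable X" "summable Y" "\<not> summable (\<lambda>n. X n * \<tau> n powr (2 - 2 * \<alpha>1))"
    "\<not> summable (\<lambda>n. Y n * \<tau> n powr (2 - 2 * \<alpha>2))"
    by (rule factorization_with_divergent_moments[OF E_pos E_sum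
        \<sigma>_lim[OF assms(13)] \<sigma>_lim[OF assms(15)]]) blast

  \<comment> \<open>\<open>r\<close> is chosen so that the terms of the weighted norm of \<open>a\<close> are \<open>X\<close>; then \<open>b\<close> is forced by the
  prescribed product, and the terms of its weighted norm are \<open>E\<^sup>2 / X = Y\<close>.\<close>
  define r where "r n = sqrt (X n / (\<nu> n * \<tau> n powr (2 * \<alpha>1)))" for n
  have r_pos: "0 < r n" for n using XY(1)[of n] \<nu>[of n] \<tau>[of n] by (simp add: r_def)
  have r2: "(r n)\<^sup>2 = X n / (\<nu> n * \<tau> n powr (2 * \<alpha>1))" for n
    using XY(1)[of n] \<nu>[of n] by (simp add: r_def less_imp_le)
  obtain a where a: "a \<in> borel_measurable borel" "\<And>n. a (s n) = complex_of_real (r n)"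
    by (rule ex_function_with_values_at_atoms[of "\<lambda>n. of_real (r n)"]) blast
  obtain b where b: "b \<in> borel_measurable borel"
      "\<And>n. b (s n) = cnj (d n / of_real ((t n)\<^sup>2 * \<nu> n * r n))"
    by (rule ex_function_with_values_at_atoms[of "\<lambda>n. cnj (d n / of_real ((t n)\<^sup>2 * \<nu> n * r n))"]) blast
  have a_weight: "\<nu> n * (cmod (a (s n)))\<^sup>2 = X n * \<tau> n powr (- (2 * \<alpha>1))" for n
    using \<nu>[of n] \<tau>[of n] r_pos[of n] by (simp add: a(2) r2 powr_minus divide_inverse)
  have b_weight: "\<nu> n * (cmod (b (s n)))\<^sup>2 = Y n * \<tau> n powr (- (2 * \<alpha>2))" for n
  proof -
    have "cmod (b (s n)) = cmod (d n) / ((\<tau> n)\<^sup>2 * \<nu> n * r n)"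
      using \<nu>[of n] r_pos[of n] by (simp add: b(2) norm_divide norm_mult \<tau>_def norm_power)
    then have "\<nu> n * (cmod (b (s n)))\<^sup>2 = (cmod (d n))\<^sup>2 / ((\<tau> n) ^ 4 * (\<nu> n * (r n)\<^sup>2))"
      using \<nu>[of n] by (simp add: power_divide power_mult_distrib power2_eq_square power4_eq_xxxx)
    also have "\<nu> n * (r n)\<^sup>2 = X n * \<tau> n powr (- (2 * \<alpha>1))"
      using \<nu>[of n] by (simp add: r2 powr_minus divide_inverse)
    also have "(\<tau> n) ^ 4 = \<tau> n powr 4"
      using powr_realpow[OF \<tau>[of n], of 4] by simp
    also have "(cmod (d n))\<^sup>2 = (E n)\<^sup>2 * \<tau> n powr (4 - 2 * \<alpha>1 - 2 * \<alpha>2)"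
    proof -
      have "(\<tau> n powr (\<alpha>1 + \<alpha>2 - 2))\<^sup>2 * \<tau> n powr (4 - 2 * \<alpha>1 - 2 * \<alpha>2) = 1"
        using \<tau>[of n] by (simp add: power2_eq_square powr_add[symmetric])
      then show ?thesis by (simp add: E_def power_mult_distrib mult.assoc)
    qed
    also have "\<tau> n powr (4 - 2 * \<alpha>1 - 2 * \<alpha>2) =
        \<tau> n powr 4 * \<tau> n powr (- (2 * \<alpha>1)) * \<tau> n powr (- (2 * \<alpha>2))"
      by (simp add: powr_add[symmetric])
    finally show ?thesis
      using XY(1)[of n] \<tau>[of n] by (simp add: XY(3)[symmetric])
  qed
  have weight: "\<nu> n * (cmod z / \<bar>s n\<bar> powr \<alpha>)\<^sup>2 = c"
    if "\<nu> n * (cmod z)\<^sup>2 = c * \<tau> n powr (- (2 * \<alpha>))" for n z \<alpha> c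
  proof -
    have "\<bar>s n\<bar> powr \<alpha> = \<tau> n powr (- \<alpha>)"
      using \<tau>[of n] by (simp add: abs_s powr_divide powr_minus_divide)
    then have "(\<bar>s n\<bar> powr \<alpha>)\<^sup>2 = \<tau> n powr (- (2 * \<alpha>))"
      by (simp add: power2_eq_square powr_add[symmetric])
    then show ?thesis using that \<tau>[of n] by (simp add: power_divide)
  qed
  have weight_x: "\<nu> n * (cmod z / s n)\<^sup>2 = c * \<tau> n powr (2 - 2 * \<alpha>)"
    if "\<nu> n * (cmod z)\<^sup>2 = c * \<tau> n powr (- (2 * \<alpha>))" for n z \<alpha> c
  proof -
    have "(cmod z / s n)\<^sup>2 = (cmod z)\<^sup>2 * (\<tau> n)\<^sup>2"
      by (simp add: s_t power_mult_distrib \<tau>_def)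
    also have "(\<tau> n)\<^sup>2 = \<tau> n powr 2"
      using powr_realpow[OF \<tau>[of n], of 2] by simp
    finally have "\<nu> n * (cmod z / s n)\<^sup>2 = c * (\<tau> n powr (- (2 * \<alpha>)) * \<tau> n powr 2)"
      using that by simp
    then show ?thesis by (simp add: powr_add[symmetric])
  qed
  have pw: "(\<lambda>x::real. \<bar>x\<bar> powr \<alpha>) \<in> borel_measurable borel" for \<alpha> by measurable
  have pw_nz: "\<bar>s n\<bar> powr \<alpha> \<noteq> 0" for n \<alpha> using s_nz[of n] by simp
  have id: "(\<lambda>x::real. x) \<in> borel_measurable borel" by measurable
  have aw: "a \<in> weighted_L2 (\<lambda>x. \<bar>x\<bar> powr \<alpha>1) M"
    unfolding weighted_L2_iff[OF pw pw_nz] weight[OF a_weight] using a(1) XY(4) by blast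
  have bw: "b \<in> weighted_L2 (\<lambda>x. \<bar>x\<bar> powr \<alpha>2) M"
    unfolding weighted_L2_iff[OF pw pw_nz] weight[OF b_weight] using b(1) XY(5) by blast
  have ax: "a \<notin> weighted_L2 (\<lambda>x. x) M"
    unfolding weighted_L2_iff[OF id s_nz] weight_x[OF a_weight] using XY(6) by blast
  have bx: "b \<notin> weighted_L2 (\<lambda>x. x) M"
    unfolding weighted_L2_iff[OF id s_nz] weight_x[OF b_weight] using XY(7) by blast
  have a_L2: "a \<in> L2 M" by (rule weighted_L2_powr_subset[OF assms(12) aw])
  have b_L2: "b \<in> L2 M" by (rule weighted_L2_powr_subset[OF assms(14) bw])

  have "spectrum M (rank_one_perturbation M a b) = {0}"
  proof (rule spectrum_rank_one_eq_zero[OF a_L2 b_L2 s_nz])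
    show "a (s n) \<noteq> 0" for n using r_pos[of n] by (simp add: a(2))
    show "b (s n) \<noteq> 0" for n
      using r_pos[of n] d_nz[of n] \<nu>[of n] t_nz[of n] by (simp add: b(2))
  next
    fix \<zeta> :: complex
    assume \<zeta>: "\<zeta> \<noteq> 0" and off: "\<And>n. of_real (s n) \<noteq> \<zeta>"
    \<comment> \<open>the inversion \<open>z = 1 / \<zeta>\<close> carries \<open>s n\<close> to \<open>t n\<close> and the pairing to the expansion of \<open>1 / A\<close>\<close>
    define z where "z = 1 / \<zeta>"
    have z: "z \<noteq> of_real (t n)" for n
      using \<zeta> off[of n] s_nz[of n] by (auto simp: z_def t_s field_simps)
    have Az: "A z \<noteq> 0" using zeros z by blast
    have R_a: "(\<lambda>x. a x / (of_real x - \<zeta>)) \<in> L2 M"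
      by (rule division_bounded[OF \<zeta>]) (use a_L2 in blast)
    have summand: "\<nu> n *\<^sub>R (a (s n) / (of_real (s n) - \<zeta>) * cnj (b (s n))) =
        - d n * (1 / (of_real (t n) - z) - 1 / of_real (t n))" for n
    proof -
      define T where "T = complex_of_real (t n)"
      have T: "T \<noteq> 0" "T \<noteq> z" "z \<noteq> 0"
        using t_nz[of n] z[of n] \<zeta> by (auto simp: T_def z_def)
      have prod: "\<nu> n *\<^sub>R (a (s n) * cnj (b (s n))) = d n / T\<^sup>2"
        using r_pos[of n] \<nu>[of n] by (simp add: a(2) b(2) T_def scaleR_conv_of_real)
      have diff: "of_real (s n) - \<zeta> = (z - T) / (T * z)"
        using T \<zeta> by (simp add: s_t T_def z_def field_simps)
      have "\<nu> n *\<^sub>R (a (s n) / (of_real (s n) - \<zeta>) * cnj (b (s n))) =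
          \<nu> n *\<^sub>R (a (s n) * cnj (b (s n))) / (of_real (s n) - \<zeta>)"
        by (simp add: scaleR_conv_of_real)
      also have "\<dots> = d n * (z / (T * (z - T)))"
        unfolding prod diff using T by (simp add: power2_eq_square)
      also have "z / (T * (z - T)) = - (1 / (T - z) - 1 / T)"
        using T by (simp add: divide_simps) (simp add: algebra_simps)
      finally show ?thesis
        unfolding T_def by (simp only: mult_minus_left mult_minus_right)
    qed
    have "L2_inner M (\<lambda>x. a x / (of_real x - \<zeta>)) b = 1 / A z - 1"
      using sums_unique2[OF L2_inner_sums[OF R_a b_L2, unfolded summand] expansion[OF Az]] .
    then show "1 + L2_inner M (\<lambda>x. a x / (of_real x - \<zeta>)) b \<noteq> 0"
      using Az by simp
  qed
  then show ?thesis using aw bw ax bx by blast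
qed

end
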